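(* Let $n\ge 1$, let $z,z'$ be admissible parameters, and let $s^*(r)$ be the maximal separation distance after $r$ iterations of the down-up chain $K$ (corresponding to the z-measure with parameters $z,z'$) on the $n$th level of the Young lattice. Then for all integers $r\ge 0$, $s^*(r)=\mathbb{P}(T>r)$, where $T$ is a sum of independent geometric random variables with parameters $$1-\frac{i}{n}\left(\frac{zz'+2n-i-1}{zz'+n-1}\right),\qquad 0\le i\le n-2.$$
   Context: Partitions are identified with their Young diagrams. Write $\tau\nearrow\lambda$ if the diagram of $\lambda$ is obtained from that of $\tau$ by adding one box; this box is denoted $\lambda/\tau$. The content of the box $b=(i,j)$ (row $i$, column $j$) is $c(b)=j-i$. $d_\lambda$ denotes the dimension of the irreducible representation of the symmetric group indexed by $\lambda$ (the number of standard Young tableaux of shape $\lambda$). Parameters $z,z'$ are admissible if either $z'=\bar z$ with $z\in\mathbb{C}\setminus\mathbb{R}$, or $z,z'$ are real and there is $m\in\mathbb{Z}$ with $m<z,z'<m+1$. The z-measure on partitions $\lambda$ of $n$ is $$\pi(\lambda)=\frac{\prod_{b\in\lambda}(z+c(b))(z'+c(b))}{zz'(zz'+1)\cdots(zz'+n-1)}\,\frac{d_\lambda^2}{n!}.$$ The down-up chain on the $n$th level of the Young lattice is the Markov chain $K$ on partitions of $n$ which moves from $\lambda$ to $\rho$ with probability $$K(\lambda,\rho)=\frac{d_\rho}{n\,d_\lambda}\sum_{|\tau|=n-1,\ \tau\nearrow\lambda,\ \tau\nearrow\rho}\frac{(z+c(\rho/\tau))(z'+c(\rho/\tau))}{zz'+n-1}.$$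 It is reversible with stationary distribution $\pi$. The maximal separation distance is $s^*(r)=\max_{x,y}\left[1-\frac{K^r(x,y)}{\pi(y)}\right]$. A geometric random variable $X$ with parameter $p\in(0,1]$ satisfies $\mathbb{P}(X=m)=p(1-p)^{m-1}$ for $m\ge1$. An empty sum is $0$. *)

theory Defs
  imports "HOL-Probability.Probability"
begin

text \<open>
  A partition is represented by its Young diagram, a finite set of boxes \<open>(i, j)\<close>
  (row, column), both coordinates starting at 1.
\<close>

type_synonym diagram = "(nat \<times> nat) set"

definition young_diagram :: "diagram \<Rightarrow> bool" where
  "young_diagram D \<longleftrightarrow> finite D \<and>
     (\<forall>(i, j) \<in> D. 1 \<le> i \<and> 1 \<le> j) \<and>
     (\<forall>i j i' j'. (i, j) \<in> D \<longrightarrow> 1 \<le> i' \<longrightarrow> i' \<le> i \<longrightarrow> 1 \<le> j' \<longrightarrow> j' \<le> j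
        \<longrightarrow> (i', j') \<in> D)"

definition partitions :: "nat \<Rightarrow> diagram set" where
  "partitions n = {D. young_diagram D \<and> card D = n}"

definition adds_box :: "diagram \<Rightarrow> diagram \<Rightarrow> bool" (infix "\<nearrow>" 50) where
  "\<tau> \<nearrow> D \<longleftrightarrow> young_diagram \<tau> \<and> young_diagram D \<and> (\<exists>b. b \<notin> \<tau> \<and> D = insert b \<tau>)"

definition added_box :: "diagram \<Rightarrow> diagram \<Rightarrow> nat \<times> nat" where
  "added_box D \<tau> = the_elem (D - \<tau>)"

definition box_content :: "nat \<times> nat \<Rightarrow> int" where
  "box_content b = int (snd b) - int (fst b)"

text \<open>
  Tableaux are extensional functions on the diagram, so that each filling is counted once.
\<close>

definition standard_tableaux :: "diagram \<Rightarrow> (nat \<times> nat \<Rightarrow> nat) set" where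
  "standard_tableaux D = {t \<in> D \<rightarrow>\<^sub>E {1..card D}. bij_betw t D {1..card D} \<and>
     (\<forall>i j j'. (i, j) \<in> D \<longrightarrow> (i, j') \<in> D \<longrightarrow> j < j' \<longrightarrow> t (i, j) < t (i, j')) \<and>
     (\<forall>i i' j. (i, j) \<in> D \<longrightarrow> (i', j) \<in> D \<longrightarrow> i < i' \<longrightarrow> t (i, j) < t (i', j))}"

definition num_tableaux :: "diagram \<Rightarrow> nat" where
  "num_tableaux D = card (standard_tableaux D)"

definition admissible_params :: "complex \<Rightarrow> complex \<Rightarrow> bool" where
  "admissible_params z z' \<longleftrightarrow> (z \<notin> \<real> \<and> z' = cnj z) \<or>
     (\<exists>x y :: real. \<exists>m :: int. z = of_real x \<and> z' = of_real y \<and>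
        of_int m < x \<and> x < of_int m + 1 \<and> of_int m < y \<and> y < of_int m + 1)"

text \<open>
  For admissible parameters the complex expressions below are real numbers
  (lemmas \<open>z_measure_eq\<close>, \<open>down_up_eq\<close> and \<open>geom_param_eq\<close>), so taking the real part only
  changes the type. \<open>pochhammer a n\<close> is \<open>a (a + 1) \<cdots> (a + n - 1)\<close>.
\<close>

definition z_measure :: "complex \<Rightarrow> complex \<Rightarrow> nat \<Rightarrow> diagram \<Rightarrow> real" where
  "z_measure z z' n D = Re (
     (\<Prod>b\<in>D. (z + of_int (box_content b)) * (z' + of_int (box_content b))) / pochhammer (z * z') n
       * (of_nat (num_tableaux D ^ 2) / fact n))"

definition down_up :: "complex \<Rightarrow> complex \<Rightarrow> nat \<Rightarrow> diagram \<Rightarrow> diagram \<Rightarrow> real" where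
  "down_up z z' n D E = Re (
     of_nat (num_tableaux E) / (of_nat n * of_nat (num_tableaux D)) *
     (\<Sum>\<tau> | \<tau> \<in> partitions (n - 1) \<and> \<tau> \<nearrow> D \<and> \<tau> \<nearrow> E.
        (z + of_int (box_content (added_box E \<tau>))) * (z' + of_int (box_content (added_box E \<tau>)))
          / (z * z' + of_nat n - 1)))"

primrec kernel_power ::
  "'s set \<Rightarrow> ('s \<Rightarrow> 's \<Rightarrow> real) \<Rightarrow> nat \<Rightarrow> 's \<Rightarrow> 's \<Rightarrow> real" where
  "kernel_power S K 0 x y = (if x = y then 1 else 0)"
| "kernel_power S K (Suc r) x y = (\<Sum>w\<in>S. K x w * kernel_power S K r w y)"

definition max_separation ::
  "'s set \<Rightarrow> ('s \<Rightarrow> 's \<Rightarrow> real) \<Rightarrow> ('s \<Rightarrow> real) \<Rightarrow> nat \<Rightarrow> real" where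
  "max_separation S K \<pi> r = (MAX (x, y) \<in> S \<times> S. 1 - kernel_power S K r x y / \<pi> y)"

definition s_star :: "complex \<Rightarrow> complex \<Rightarrow> nat \<Rightarrow> nat \<Rightarrow> real" where
  "s_star z z' n r = max_separation (partitions n) (down_up z z' n) (z_measure z z' n) r"

text \<open>
  This law lives on \<open>{1, 2, \<dots>}\<close>, whereas the library's \<open>geometric_pmf\<close> lives on
  \<open>{0, 1, \<dots>}\<close>. For \<open>p \<in> {0<..1}\<close> the values on \<open>m \<ge> 1\<close> sum to 1, so \<open>X = 0\<close> has
  probability 0.
\<close>

definition geometric_rv :: "'a measure \<Rightarrow> real \<Rightarrow> ('a \<Rightarrow> nat) \<Rightarrow> bool" where
  "geometric_rv M p X \<longleftrightarrow> X \<in> measurable M (count_space UNIV) \<and>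
     (\<forall>m\<ge>1. measure M {\<omega> \<in> space M. X \<omega> = m} = p * (1 - p) ^ (m - 1))"

definition geom_param :: "complex \<Rightarrow> complex \<Rightarrow> nat \<Rightarrow> nat \<Rightarrow> real" where
  "geom_param z z' n i = Re (1 - of_nat i / of_nat n *
     ((z * z' + 2 * of_nat n - of_nat i - 1) / (z * z' + of_nat n - 1)))"

lemma admissible_real:
  assumes "admissible_params z z'"
  shows "(z + of_int c) * (z' + of_int c) \<in> \<real>"
  using assms unfolding admissible_params_def
proof (elim disjE exE conjE)
  assume "z' = cnj z"
  then have "(z + of_int c) * (z' + of_int c) = (z + of_int c) * cnj (z + of_int c)"
    by simp
  then show ?thesis
    by (metis complex_mult_cnj Reals_of_real)
qed auto

lemma admissible_mult_real: "admissible_params z z' \<Longrightarrow> z * z' \<in> \<real>"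
  using admissible_real[of z z' 0] by simp

lemma admissible_mult_pos:
  assumes "admissible_params z z'"
  shows "0 < Re (z * z')"
  using assms unfolding admissible_params_def
proof (elim disjE exE conjE)
  assume z: "z \<notin> \<real>" "z' = cnj z"
  then have "Im z \<noteq> 0"
    by (simp add: complex_is_Real_iff)
  then show ?thesis
    using z by (simp add: add_nonneg_pos flip: power2_eq_square)
next
  fix x y :: real and m :: int
  assume "z = of_real x" "z' = of_real y"
    and b: "of_int m < x" "x < of_int m + 1" "of_int m < y" "y < of_int m + 1"
  moreover have "0 < x * y"
  proof (cases "m \<ge> 0")
    case True
    then have "(0::real) \<le> of_int m" by simp
    with b show ?thesis by (intro mult_pos_pos) linarith+
  next
    case False
    then have "of_int m + 1 \<le> (0::real)" by linarith
    with b show ?thesis by (intro mult_neg_neg) linarith+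
  qed
  ultimately show ?thesis by simp
qed

lemma z_measure_eq:
  assumes "admissible_params z z'"
  shows "complex_of_real (z_measure z z' n D) =
    (\<Prod>b\<in>D. (z + of_int (box_content b)) * (z' + of_int (box_content b))) / pochhammer (z * z') n
       * (of_nat (num_tableaux D ^ 2) / fact n)"
  unfolding z_measure_def
proof -
  have "pochhammer (z * z') n \<in> \<real>"
    unfolding pochhammer_prod
    by (intro prod_in_Reals Reals_add admissible_mult_real[OF assms]) auto
  moreover have "(fact n :: complex) \<in> \<real>"
    by (metis Reals_of_nat of_nat_fact)
  ultimately show "complex_of_real (Re (
     (\<Prod>b\<in>D. (z + of_int (box_content b)) * (z' + of_int (box_content b)))
       / pochhammer (z * z') n * (of_nat (num_tableaux D ^ 2) / fact n))) =
     (\<Prod>b\<in>D. (z + of_int (box_content b)) * (z' + of_int (box_content b)))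
       / pochhammer (z * z') n * (of_nat (num_tableaux D ^ 2) / fact n)"
    by (intro of_real_Re Reals_mult Reals_divide prod_in_Reals admissible_real[OF assms]
          Reals_of_nat)
qed

lemma down_up_eq:
  assumes "admissible_params z z'"
  shows "complex_of_real (down_up z z' n D E) =
    of_nat (num_tableaux E) / (of_nat n * of_nat (num_tableaux D)) *
     (\<Sum>\<tau> | \<tau> \<in> partitions (n - 1) \<and> \<tau> \<nearrow> D \<and> \<tau> \<nearrow> E.
        (z + of_int (box_content (added_box E \<tau>))) * (z' + of_int (box_content (added_box E \<tau>)))
          / (z * z' + of_nat n - 1))"
  unfolding down_up_def
  by (intro of_real_Re Reals_mult Reals_divide sum_in_Reals Reals_diff Reals_add
        admissible_real[OF assms] admissible_mult_real[OF assms]) auto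

lemma geom_param_eq:
  assumes "admissible_params z z'"
  shows "complex_of_real (geom_param z z' n i) =
    1 - of_nat i / of_nat n *
     ((z * z' + 2 * of_nat n - of_nat i - 1) / (z * z' + of_nat n - 1))"
  unfolding geom_param_def
  by (intro of_real_Re Reals_mult Reals_divide Reals_diff Reals_add
        admissible_mult_real[OF assms]) auto

lemma geom_param_bounds:
  assumes "admissible_params z z'" "i < n - 1"
  shows "geom_param z z' n i \<in> {0<..1}"
proof -
  define t where "t = Re (z * z')"
  have t: "z * z' = of_real t" "0 < t"
    using of_real_Re[OF admissible_mult_real[OF assms(1)], symmetric]
      admissible_mult_pos[OF assms(1)]
    unfolding t_def by blast+
  have i: "real i + 2 \<le> real n" using assms(2) by linarith
  have "geom_param z z' n i =
      1 - real i / real n * ((t + 2 * real n - real i - 1) / (t + real n - 1))"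
  proof -
    have "complex_of_real (geom_param z z' n i) =
      complex_of_real (1 - real i / real n * ((t + 2 * real n - real i - 1) / (t + real n - 1)))"
      unfolding geom_param_eq[OF assms(1)] t(1) by simp
    then show ?thesis using of_real_eq_iff by blast
  qed
  also have "\<dots> = (real n - i) * (t + real n - i - 1) / (real n * (t + real n - 1))"
    using i t(2) by (simp add: divide_simps) (simp add: algebra_simps)
  finally have eq: "geom_param z z' n i = \<dots>" .
  have "0 < (real n - i) * (t + real n - i - 1)" "0 < real n * (t + real n - 1)"
    using i t(2) by (auto intro!: mult_pos_pos)
  moreover have "(real n - i) * (t + real n - i - 1) \<le> real n * (t + real n - 1)"
    using i t(2) by (intro mult_mono) auto
  ultimately show ?thesis unfolding eq by simp
qed

end

theory Submission
  imports Defs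
begin

text \<open>
  Let \<open>D\<close> and \<open>U\<close> be the operators on functions of diagrams that remove a box and, with weight
  \<open>(z + c)(z' + c)\<close>, add a box of content \<open>c\<close>. The sum of a function of the content over the addable
  boxes minus that over the removable boxes is computed by its second differences, which gives
  \<open>U D - D U = z z' + 2 |\<tau>|\<close> at the diagram \<open>\<tau>\<close>. Hence the kernels \<open>W\<^sub>k\<close>, "\<open>k\<close> steps down, then \<open>k\<close>
  steps up", satisfy \<open>K W\<^sub>k = p\<^sub>k W\<^bsub>k+1\<^esub> + (1 - p\<^sub>k) W\<^sub>k\<close>, and \<open>K\<^sup>r\<close> is the mixture of the \<open>W\<^sub>k\<close>
  by the law at time \<open>r\<close> of a pure birth chain that leaves \<open>k\<close> with probability \<open>p\<^sub>k\<close>, the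
  \<open>k\<close>-th parameter of the theorem. Both \<open>W\<^bsub>n-1\<^esub>\<close> and \<open>W\<^sub>n\<close> are the projection onto \<open>\<pi>\<close>,
  and all \<open>W\<^sub>k\<close> are nonnegative; those with \<open>k < n - 1\<close> do not lead from the one-row diagram to the
  one-column diagram. So this pair attains the maximal separation, which is the probability that
  the birth chain has not reached \<open>n - 1\<close>; the time to reach it is a sum of independent geometric
  waiting times.
\<close>

section \<open>Addable and removable boxes\<close>

lemma young_diagram_pos: "young_diagram D \<Longrightarrow> (i, j) \<in> D \<Longrightarrow> 1 \<le> i \<and> 1 \<le> j"
  unfolding young_diagram_def by auto

lemma young_diagram_below:
  "young_diagram D \<Longrightarrow> (i, j) \<in> D \<Longrightarrow> 1 \<le> i' \<Longrightarrow> i' \<le> i \<Longrightarrow> 1 \<le> j' \<Longrightarrow> j' \<le> j \<Longrightarrow> (i', j') \<in> D"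
  unfolding young_diagram_def by blast

lemma young_diagram_finite: "young_diagram D \<Longrightarrow> finite D"
  unfolding young_diagram_def by auto

lemma young_diagram_Int: "young_diagram D \<Longrightarrow> young_diagram E \<Longrightarrow> young_diagram (D \<inter> E)"
  unfolding young_diagram_def by blast

lemma young_diagram_Un: "young_diagram D \<Longrightarrow> young_diagram E \<Longrightarrow> young_diagram (D \<union> E)"
  unfolding young_diagram_def by blast

lemma young_diagram_empty: "young_diagram {}"
  unfolding young_diagram_def by auto

text \<open>A box \<open>(i, j)\<close> of \<open>D\<close> forces the whole \<open>i\<close> by
  \<open>j\<close> rectangle into \<open>D\<close>, so \<open>i * j\<close> is at most
  \<open>card D\<close>. This bounds the diagrams of a given size and gives
  \<open>sum_corners\<close> a finite range of windows.\<close>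

lemma young_diagram_subset_square:
  assumes "young_diagram D"
  shows "D \<subseteq> {1..card D} \<times> {1..card D}"
proof
  fix b assume "b \<in> D"
  then obtain i j where b: "b = (i, j)" "(i, j) \<in> D" by (cases b) auto
  have pos: "1 \<le> i" "1 \<le> j" using young_diagram_pos[OF assms b(2)] by auto
  have "{1..i} \<times> {1..j} \<subseteq> D"
    using young_diagram_below[OF assms b(2)] by auto
  then have "card ({1..i} \<times> {1..j}) \<le> card D"
    using young_diagram_finite[OF assms] card_mono by blast
  then have "i * j \<le> card D" by (simp add: card_cartesian_product)
  moreover have "i * 1 \<le> i * j" "1 * j \<le> i * j" using pos by (intro mult_le_mono; simp)+
  ultimately have "i \<le> card D" "j \<le> card D" by linarith+
  then show "b \<in> {1..card D} \<times> {1..card D}" using pos b by simp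
qed

lemma finite_partitions: "finite (partitions n)"
proof (rule finite_subset)
  show "partitions n \<subseteq> Pow ({1..n} \<times> {1..n})"
    unfolding partitions_def using young_diagram_subset_square by blast
qed auto

lemma partitions_young: "D \<in> partitions n \<Longrightarrow> young_diagram D"
  and partitions_card: "D \<in> partitions n \<Longrightarrow> card D = n"
  unfolding partitions_def by auto

section \<open>The covering relation of the Young lattice\<close>

lemma adds_box_young:
  assumes "\<tau> \<nearrow> D"
  shows "young_diagram \<tau>" "young_diagram D"
  using assms unfolding adds_box_def by auto

lemma adds_box_insert:
  assumes "\<tau> \<nearrow> D"
  shows "added_box D \<tau> \<notin> \<tau>" "D = insert (added_box D \<tau>) \<tau>"
  using assms unfolding adds_box_def added_box_def by (auto simp: insert_Diff_if)

lemma adds_box_card: "\<tau> \<nearrow> D \<Longrightarrow> card D = Suc (card \<tau>)"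
  by (metis adds_box_insert adds_box_young(1) card_insert_disjoint young_diagram_finite)

lemma adds_boxI: "young_diagram \<tau> \<Longrightarrow> young_diagram (insert b \<tau>) \<Longrightarrow> b \<notin> \<tau> \<Longrightarrow> \<tau> \<nearrow> insert b \<tau>"
  unfolding adds_box_def by blast

lemma added_box_insert [simp]: "b \<notin> \<tau> \<Longrightarrow> added_box (insert b \<tau>) \<tau> = b"
  unfolding added_box_def by (simp add: insert_Diff_if)

lemma adds_box_partitions:
  assumes "\<tau> \<nearrow> D"
  shows "D \<in> partitions (Suc m) \<longleftrightarrow> \<tau> \<in> partitions m"
  using adds_box_young[OF assms] adds_box_card[OF assms] unfolding partitions_def by auto

lemma finite_adds_box_above: "finite {D. \<tau> \<nearrow> D}"
proof (rule finite_subset)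
  show "{D. \<tau> \<nearrow> D} \<subseteq> partitions (Suc (card \<tau>))"
    using adds_box_young adds_box_card unfolding partitions_def by auto
qed (rule finite_partitions)

lemma finite_adds_box_below: "finite {\<tau>. \<tau> \<nearrow> D}"
proof (rule finite_subset)
  show "{\<tau>. \<tau> \<nearrow> D} \<subseteq> partitions (card D - 1)"
    using adds_box_young adds_box_card unfolding partitions_def by auto
qed (rule finite_partitions)

definition addable :: "diagram \<Rightarrow> (nat \<times> nat) set" where
  "addable D = {b. b \<notin> D \<and> young_diagram (insert b D)}"

definition removable :: "diagram \<Rightarrow> (nat \<times> nat) set" where
  "removable D = {b. b \<in> D \<and> young_diagram (D - {b})}"

text \<open>Together with \<open>sum_adds_box_below\<close> this trades sums over neighbouring
  diagrams for sums over corner boxes, to which \<open>sum_corners\<close> applies.\<close>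

lemma sum_adds_box_above:
  fixes g :: "nat \<times> nat \<Rightarrow> real"
  assumes "young_diagram \<tau>"
  shows "(\<Sum>D | \<tau> \<nearrow> D. g (added_box D \<tau>)) = (\<Sum>b\<in>addable \<tau>. g b)"
  by (rule sum.reindex_bij_witness[where i = "\<lambda>b. insert b \<tau>" and j = "\<lambda>D. added_box D \<tau>"])
    (use assms adds_box_insert adds_box_young adds_boxI in \<open>force simp: addable_def\<close>)+

lemma sum_adds_box_below:
  fixes g :: "nat \<times> nat \<Rightarrow> real"
  assumes "young_diagram D"
  shows "(\<Sum>\<tau> | \<tau> \<nearrow> D. g (added_box D \<tau>)) = (\<Sum>b\<in>removable D. g b)"
proof (rule sum.reindex_bij_witness[where i = "\<lambda>b. D - {b}" and j = "\<lambda>\<tau>. added_box D \<tau>"])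
  fix \<tau> assume "\<tau> \<in> {\<tau>. \<tau> \<nearrow> D}"
  then have t: "\<tau> \<nearrow> D" by simp
  show eq: "D - {added_box D \<tau>} = \<tau>" 
    using adds_box_insert[OF t] by auto
  show "added_box D \<tau> \<in> removable D"
    unfolding removable_def mem_Collect_eq eq
    using adds_box_insert(2)[OF t] adds_box_young(1)[OF t] by auto
next
  fix b assume b: "b \<in> removable D"
  then have D: "insert b (D - {b}) = D" unfolding removable_def by auto
  then show "added_box D (D - {b}) = b"
    using added_box_insert[of b "D - {b}"] by simp
  show "D - {b} \<in> {\<tau>. \<tau> \<nearrow> D}"
    using b adds_boxI[of "D - {b}" b] assms unfolding D removable_def by simp
qed simp

text \<open>Only the left and the upper neighbour matter, since each of them forces all boxes
  further up and to the left. With successors as coordinates, the value 0 of \<open>i\<close> or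
  \<open>j\<close> stands for the border, where no neighbour is required.\<close>

lemma addable_iff:
  assumes "young_diagram D"
  shows "(Suc i, Suc j) \<in> addable D \<longleftrightarrow>
    (Suc i, Suc j) \<notin> D \<and> (i = 0 \<or> (i, Suc j) \<in> D) \<and> (j = 0 \<or> (Suc i, j) \<in> D)"
    (is "?L \<longleftrightarrow> ?R")
proof
  assume L: ?L
  then have y: "young_diagram (insert (Suc i, Suc j) D)" and n: "(Suc i, Suc j) \<notin> D"
    unfolding addable_def by auto
  have "i = 0 \<or> (i, Suc j) \<in> D"
    using young_diagram_below[OF y, of "Suc i" "Suc j" i "Suc j"] by fastforce
  moreover have "j = 0 \<or> (Suc i, j) \<in> D"
    using young_diagram_below[OF y, of "Suc i" "Suc j" "Suc i" j] by fastforce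
  ultimately show ?R using n by blast
next
  assume R: ?R
  have "(i', j') \<in> insert (Suc i, Suc j) D"
    if "1 \<le> i'" "i' \<le> Suc i" "1 \<le> j'" "j' \<le> Suc j" for i' j'
  proof (cases "i' = Suc i")
    case True
    show ?thesis
    proof (cases "j' = Suc j")
      case False
      then have "j \<noteq> 0" using that by auto
      then have "(Suc i, j) \<in> D" using R by auto
      then show ?thesis using young_diagram_below[OF assms, of "Suc i" j i' j'] that False by auto
    qed (use True in auto)
  next
    case False
    then have "i \<noteq> 0" using that by auto
    then have "(i, Suc j) \<in> D" using R by auto
    then show ?thesis using young_diagram_below[OF assms, of i "Suc j" i' j'] that False by auto
  qed
  then have "young_diagram (insert (Suc i, Suc j) D)"
    using assms unfolding young_diagram_def by auto
  then show ?L using R unfolding addable_def by auto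
qed

lemma removable_iff:
  assumes "young_diagram D"
  shows "(i, j) \<in> removable D \<longleftrightarrow> (i, j) \<in> D \<and> (Suc i, j) \<notin> D \<and> (i, Suc j) \<notin> D"
    (is "?L \<longleftrightarrow> ?R")
proof
  assume L: ?L
  then have y: "young_diagram (D - {(i, j)})" and n: "(i, j) \<in> D"
    unfolding removable_def by auto
  have ij: "1 \<le> i" "1 \<le> j" using young_diagram_pos[OF assms n] by auto
  have "(Suc i, j) \<notin> D"
    using young_diagram_below[OF y, of "Suc i" j i j] ij by fastforce
  moreover have "(i, Suc j) \<notin> D"
    using young_diagram_below[OF y, of i "Suc j" i j] ij by fastforce
  ultimately show ?R using n by blast
next
  assume R: ?R
  have ij: "1 \<le> i" "1 \<le> j" using young_diagram_pos[OF assms, of i j] R by auto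
  have "\<not> (i \<le> a \<and> j \<le> b)" if "(a, b) \<in> D" "(a, b) \<noteq> (i, j)" for a b
  proof
    assume le: "i \<le> a \<and> j \<le> b"
    then have "Suc i \<le> a \<or> Suc j \<le> b" using that(2) by auto
    then show False
      using young_diagram_below[OF assms that(1), of "Suc i" j]
        young_diagram_below[OF assms that(1), of i "Suc j"] le R ij by auto
  qed
  then have "young_diagram (D - {(i, j)})"
    using assms unfolding young_diagram_def by (auto; blast)
  then show ?L using R unfolding removable_def by auto
qed

text \<open>
  In each \<open>2 \<times> 2\<close> window with upper left corner \<open>(i, j)\<close>, an addable box can only sit at the lower
  right and a removable one at the upper left, and both have content \<open>j - i\<close>. Windows may overlap
  the row and column with index 0, which account for the term \<open>(0, 0)\<close>.
\<close>

lemma corner_indicator: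
  assumes "young_diagram D"
  shows "(of_bool ((Suc i, Suc j) \<in> addable D) :: real) - of_bool ((i, j) \<in> removable D) =
    of_bool (i = 0 \<and> j = 0) + of_bool ((i, Suc j) \<in> D) + of_bool ((Suc i, j) \<in> D)
      - of_bool ((Suc i, Suc j) \<in> D) - of_bool ((i, j) \<in> D)"
proof -
  have z: "(0, b) \<notin> D" "(b, 0) \<notin> D" for b using young_diagram_pos[OF assms] by force+
  have m: "i \<noteq> 0 \<Longrightarrow> (i, Suc j) \<in> D" "j \<noteq> 0 \<Longrightarrow> (Suc i, j) \<in> D" if "(Suc i, Suc j) \<in> D"
    using young_diagram_below[OF assms that] by auto
  have m1: "j \<noteq> 0 \<Longrightarrow> (i, j) \<in> D" if "(i, Suc j) \<in> D"
    using young_diagram_below[OF assms that, of i j] young_diagram_pos[OF assms that] by auto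
  have m2: "i \<noteq> 0 \<Longrightarrow> (i, j) \<in> D" if "(Suc i, j) \<in> D"
    using young_diagram_below[OF assms that, of i j] young_diagram_pos[OF assms that] by auto
  show ?thesis
    unfolding addable_iff[OF assms] removable_iff[OF assms]
    using z m m1 m2 by (cases "i = 0"; cases "j = 0") (auto simp: of_bool_def)
qed

text \<open>Weight \<open>corner_indicator\<close> by \<open>g (j - i)\<close> and sum over all
  windows. A box of \<open>D\<close> of content c is the upper right of a window on diagonal c - 1,
  the lower left of one on diagonal c + 1, and lies on the main diagonal of two windows on diagonal
  c; hence the second difference. The window at \<open>(0, 0)\<close> leaves
  \<open>g 0\<close>.\<close>

lemma sum_corners:
  fixes g :: "int \<Rightarrow> real"
  assumes "young_diagram D"
  shows "(\<Sum>b\<in>addable D. g (box_content b)) - (\<Sum>b\<in>removable D. g (box_content b)) =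
    g 0 + (\<Sum>b\<in>D. g (box_content b - 1) + g (box_content b + 1) - 2 * g (box_content b))"
proof -
  \<comment> \<open>The upper left corners of the windows. The range starts at 0 to include the
    windows that overlap the border and is large enough to see every relevant box in each
    position.\<close>
  define A where "A = {..Suc (card D)} \<times> {..Suc (card D)}"
  have fin: "finite A" unfolding A_def by auto
  have sq: "i \<in> {1..card D} \<and> j \<in> {1..card D}" if "(i, j) \<in> D" for i j
    using young_diagram_subset_square[OF assms] that by auto
  have sqa: "i \<in> {1..Suc (card D)} \<and> j \<in> {1..Suc (card D)}" if "(i, j) \<in> addable D" for i j
  proof -
    from that have n: "(i, j) \<notin> D" and y: "young_diagram (insert (i, j) D)"
      unfolding addable_def by auto
    have "card (insert (i, j) D) = Suc (card D)"
      using n young_diagram_finite[OF assms] by simp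
    then show ?thesis using young_diagram_subset_square[OF y] by auto
  qed
  \<comment> \<open>\<open>(k, l)\<close> is the position inside the window at which the box of
    \<open>B\<close> sits; passing from the box to the upper left corner shifts the content by
    \<open>k - l\<close>.\<close>
  have ind: "(\<Sum>p\<in>A. of_bool ((fst p + k, snd p + l) \<in> B) * g (int (snd p) - int (fst p))) =
      (\<Sum>b\<in>B. g (box_content b + (int k - int l)))"
    if B: "B \<subseteq> {1..Suc (card D)} \<times> {1..Suc (card D)}" and kl: "k \<le> 1" "l \<le> 1" for B k l
  proof -
    have "(\<Sum>b\<in>B. g (box_content b + (int k - int l))) =
        (\<Sum>p | p \<in> A \<and> (fst p + k, snd p + l) \<in> B. g (int (snd p) - int (fst p)))"
    proof (rule sum.reindex_bij_witness[where i = "\<lambda>p. (fst p + k, snd p + l)"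
          and j = "\<lambda>b. (fst b - k, snd b - l)"])
      fix b assume "b \<in> B"
      then have "k \<le> fst b" "l \<le> snd b" "fst b \<le> Suc (card D)" "snd b \<le> Suc (card D)"
        and b: "b \<in> B" using B kl by force+
      then show "(fst (fst b - k, snd b - l) + k, snd (fst b - k, snd b - l) + l) = b"
        "(fst b - k, snd b - l) \<in> {p. p \<in> A \<and> (fst p + k, snd p + l) \<in> B}"
        "g (int (snd (fst b - k, snd b - l)) - int (fst (fst b - k, snd b - l))) =
          g (box_content b + (int k - int l))"
        by (auto simp: A_def box_content_def of_nat_diff algebra_simps)
    qed auto
    also have "\<dots> = (\<Sum>p\<in>A. if (fst p + k, snd p + l) \<in> B then g (int (snd p) - int (fst p)) else 0)"
      by (rule sum.inter_filter[OF fin])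
    also have "\<dots> = (\<Sum>p\<in>A. of_bool ((fst p + k, snd p + l) \<in> B) * g (int (snd p) - int (fst p)))"
      by (intro sum.cong) auto
    finally show ?thesis ..
  qed
  have sD: "D \<subseteq> {1..Suc (card D)} \<times> {1..Suc (card D)}"
    using sq by fastforce
  have sa: "addable D \<subseteq> {1..Suc (card D)} \<times> {1..Suc (card D)}"
    using sqa by auto
  have sr: "removable D \<subseteq> {1..Suc (card D)} \<times> {1..Suc (card D)}"
    using sD unfolding removable_def by auto
  have zero: "(\<Sum>p\<in>A. of_bool (fst p = 0 \<and> snd p = 0) * g (int (snd p) - int (fst p))) = g 0"
  proof -
    have "(\<Sum>p\<in>A. of_bool (fst p = 0 \<and> snd p = 0) * g (int (snd p) - int (fst p))) =
        (\<Sum>p\<in>A. if p = (0, 0) then g 0 else 0)"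
      by (intro sum.cong) auto
    also have "\<dots> = g 0" using fin by (simp add: A_def)
    finally show ?thesis .
  qed
  \<comment> \<open>The summands \<open>+ 0\<close> are kept so that every sum is literally an
    instance of \<open>ind\<close>.\<close>
  have "(\<Sum>p\<in>A. of_bool ((fst p + 1, snd p + 1) \<in> addable D) * g (int (snd p) - int (fst p)))
      - (\<Sum>p\<in>A. of_bool ((fst p + 0, snd p + 0) \<in> removable D) * g (int (snd p) - int (fst p))) =
      (\<Sum>p\<in>A. of_bool (fst p = 0 \<and> snd p = 0) * g (int (snd p) - int (fst p)))
      + (\<Sum>p\<in>A. of_bool ((fst p + 0, snd p + 1) \<in> D) * g (int (snd p) - int (fst p)))
      + (\<Sum>p\<in>A. of_bool ((fst p + 1, snd p + 0) \<in> D) * g (int (snd p) - int (fst p)))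
      - (\<Sum>p\<in>A. of_bool ((fst p + 1, snd p + 1) \<in> D) * g (int (snd p) - int (fst p)))
      - (\<Sum>p\<in>A. of_bool ((fst p + 0, snd p + 0) \<in> D) * g (int (snd p) - int (fst p)))"
    unfolding sum.distrib[symmetric] sum_subtractf[symmetric] left_diff_distrib[symmetric]
      distrib_right[symmetric]
    using corner_indicator[OF assms]
    by (intro sum.cong refl arg_cong2[where f = "(*)"]) (simp only: add_0_right Suc_eq_plus1)
  then show ?thesis
    unfolding zero by (simp only: ind[OF sD] ind[OF sa] ind[OF sr] le0 order_refl)
      (simp add: sum.distrib sum_subtractf flip: sum_distrib_left)
qed

section \<open>The commutation relation\<close>

text \<open>Both operators act on functions, so compositions read from the outside in:
  \<open>down (up v f) D\<close> sums \<open>f\<close> over the diagrams reached from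
  \<open>D\<close> by first removing a box and then adding one.\<close>

definition down :: "(diagram \<Rightarrow> real) \<Rightarrow> diagram \<Rightarrow> real" where
  "down f D = (\<Sum>\<tau> | \<tau> \<nearrow> D. f \<tau>)"

definition up :: "(int \<Rightarrow> real) \<Rightarrow> (diagram \<Rightarrow> real) \<Rightarrow> diagram \<Rightarrow> real" where
  "up v f \<tau> = (\<Sum>D | \<tau> \<nearrow> D. v (box_content (added_box D \<tau>)) * f D)"

lemma down_cong: "(\<And>\<tau>. \<tau> \<nearrow> D \<Longrightarrow> f \<tau> = g \<tau>) \<Longrightarrow> down f D = down g D"
  unfolding down_def by (intro sum.cong) auto

lemma up_cong: "(\<And>D. \<tau> \<nearrow> D \<Longrightarrow> f D = g D) \<Longrightarrow> up v f \<tau> = up v g \<tau>"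
  unfolding up_def by (intro sum.cong) auto

lemma down_add: "down (\<lambda>D. f D + g D) = (\<lambda>D. down f D + down g D)"
  unfolding down_def by (simp add: sum.distrib)

lemma down_cmult: "down (\<lambda>D. c * f D) = (\<lambda>D. c * down f D)"
  unfolding down_def by (simp add: sum_distrib_left)

lemma down_sum: "down (\<lambda>D. \<Sum>i\<in>I. f i D) = (\<lambda>D. \<Sum>i\<in>I. down (f i) D)"
  unfolding down_def by (subst sum.swap) simp

lemma up_cmult: "up v (\<lambda>D. c * f D) = (\<lambda>D. c * up v f D)"
  unfolding up_def by (simp add: sum_distrib_left mult.left_commute)

lemma up_sum: "up v (\<lambda>D. \<Sum>i\<in>I. f i D) = (\<lambda>D. \<Sum>i\<in>I. up v (f i) D)"
  unfolding up_def sum_distrib_left by (subst sum.swap) simp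

text \<open>The diamond property: \<open>\<tau>\<close> and \<open>\<sigma>\<close> lack different
  boxes of \<open>D\<close>, and these can be removed in either order. The box added is the same on
  both sides of the diamond, so the weights of the two paths agree.\<close>

lemma adds_box_exchange:
  assumes \<tau>: "\<tau> \<nearrow> D" and \<sigma>: "\<sigma> \<nearrow> D" and ne: "\<sigma> \<noteq> \<tau>"
  shows "\<tau> \<inter> \<sigma> \<nearrow> \<tau>" "\<tau> \<inter> \<sigma> \<nearrow> \<sigma>" "\<tau> \<union> \<sigma> = D"
    "added_box \<sigma> (\<tau> \<inter> \<sigma>) = added_box D \<tau>"
proof -
  define a b where "a = added_box D \<tau>" and "b = added_box D \<sigma>"
  have D: "D = insert a \<tau>" "a \<notin> \<tau>" "D = insert b \<sigma>" "b \<notin> \<sigma>"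
    unfolding a_def b_def using adds_box_insert[OF \<tau>] adds_box_insert[OF \<sigma>] by auto
  have ab: "a \<noteq> b" using D ne by (metis insert_ident)
  define \<kappa> where "\<kappa> = \<tau> \<inter> \<sigma>"
  have \<kappa>: "\<tau> = insert b \<kappa>" "b \<notin> \<kappa>" "\<sigma> = insert a \<kappa>" "a \<notin> \<kappa>"
    using D ab unfolding \<kappa>_def by auto
  have y: "young_diagram \<kappa>" "young_diagram \<tau>" "young_diagram \<sigma>"
    unfolding \<kappa>_def using adds_box_young[OF \<tau>] adds_box_young[OF \<sigma>] young_diagram_Int by auto
  show "\<tau> \<inter> \<sigma> \<nearrow> \<tau>" "\<tau> \<inter> \<sigma> \<nearrow> \<sigma>"
    unfolding \<kappa>_def[symmetric] using y adds_boxI[of \<kappa>] \<kappa> by metis+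
  show "\<tau> \<union> \<sigma> = D" using \<kappa> D ab by auto
  show "added_box \<sigma> (\<tau> \<inter> \<sigma>) = added_box D \<tau>"
    unfolding \<kappa>_def[symmetric] a_def[symmetric] using added_box_insert[OF \<kappa>(4)] \<kappa>(3) by simp
qed

lemma adds_box_exchange':
  assumes \<tau>: "\<kappa> \<nearrow> \<tau>" and \<sigma>: "\<kappa> \<nearrow> \<sigma>" and ne: "\<sigma> \<noteq> \<tau>"
  shows "\<tau> \<nearrow> \<tau> \<union> \<sigma>" "\<sigma> \<nearrow> \<tau> \<union> \<sigma>" "\<tau> \<inter> \<sigma> = \<kappa>"
proof -
  define a b where "a = added_box \<tau> \<kappa>" and "b = added_box \<sigma> \<kappa>"
  have D: "\<tau> = insert a \<kappa>" "a \<notin> \<kappa>" "\<sigma> = insert b \<kappa>" "b \<notin> \<kappa>"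
    unfolding a_def b_def using adds_box_insert[OF \<tau>] adds_box_insert[OF \<sigma>] by auto
  have ab: "a \<noteq> b" using D ne by blast
  have y: "young_diagram (\<tau> \<union> \<sigma>)" "young_diagram \<tau>" "young_diagram \<sigma>"
    using adds_box_young[OF \<tau>] adds_box_young[OF \<sigma>] young_diagram_Un by auto
  have u: "\<tau> \<union> \<sigma> = insert b \<tau>" "\<tau> \<union> \<sigma> = insert a \<sigma>" "b \<notin> \<tau>" "a \<notin> \<sigma>" using D ab by auto
  show "\<tau> \<nearrow> \<tau> \<union> \<sigma>" using y adds_boxI[of \<tau> b] u by simp
  show "\<sigma> \<nearrow> \<tau> \<union> \<sigma>" using y adds_boxI[of \<sigma> a] u by simp
  show "\<tau> \<inter> \<sigma> = \<kappa>" using D ab by auto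
qed

text \<open>Paths from \<open>\<tau>\<close> to some \<open>\<sigma>\<close> other than
  \<open>\<tau>\<close> cancel through the diamond bijection. The paths that return to
  \<open>\<tau>\<close> leave the weights of the addable boxes minus those of the removable ones. As
  \<open>v\<close> has constant second difference 2, \<open>sum_corners\<close> evaluates this with
  a contribution of 2 from each box.\<close>

lemma up_down_commute:
  fixes v :: "int \<Rightarrow> real"
  assumes v: "\<And>c. v (c - 1) + v (c + 1) = 2 * v c + 2" and \<tau>: "young_diagram \<tau>"
  shows "up v (down f) \<tau> = down (up v f) \<tau> + (v 0 + 2 * card \<tau>) * f \<tau>"
proof -
  define w where "w D \<tau> = v (box_content (added_box D \<tau>))" for D \<tau>
  have split: "(\<Sum>\<sigma> | P \<sigma>. h \<sigma>) = (if P \<tau> then h \<tau> else 0) + (\<Sum>\<sigma> | P \<sigma> \<and> \<sigma> \<noteq> \<tau>. h \<sigma>)"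
    if "finite {\<sigma>. P \<sigma>}" for P and h :: "diagram \<Rightarrow> real"
  proof (cases "P \<tau>")
    case True
    then have "{\<sigma>. P \<sigma> \<and> \<sigma> \<noteq> \<tau>} = {\<sigma>. P \<sigma>} - {\<tau>}" by auto
    then show ?thesis using that True by (simp add: sum.remove)
  next
    case False
    then have "{\<sigma>. P \<sigma> \<and> \<sigma> \<noteq> \<tau>} = {\<sigma>. P \<sigma>}" by auto
    then show ?thesis using False by simp
  qed
  have fin: "finite {\<sigma>. \<sigma> \<nearrow> D \<and> \<sigma> \<noteq> \<tau>}" "finite {\<sigma>. D \<nearrow> \<sigma> \<and> \<sigma> \<noteq> \<tau>}" for D
    using finite_adds_box_below[of D] finite_adds_box_above[of D] by (auto intro: rev_finite_subset)
  have 1: "up v (down f) \<tau> = (\<Sum>D | \<tau> \<nearrow> D. w D \<tau> * f \<tau>)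
      + (\<Sum>D | \<tau> \<nearrow> D. \<Sum>\<sigma> | \<sigma> \<nearrow> D \<and> \<sigma> \<noteq> \<tau>. w D \<tau> * f \<sigma>)"
  proof -
    have "up v (down f) \<tau> =
        (\<Sum>D | \<tau> \<nearrow> D. w D \<tau> * (f \<tau> + (\<Sum>\<sigma> | \<sigma> \<nearrow> D \<and> \<sigma> \<noteq> \<tau>. f \<sigma>)))"
      unfolding up_def down_def w_def
      by (intro sum.cong refl arg_cong2[where f = "(*)"])
        (simp add: split[OF finite_adds_box_below])
    then show ?thesis by (simp add: distrib_left sum.distrib sum_distrib_left)
  qed
  have 2: "down (up v f) \<tau> = (\<Sum>\<kappa> | \<kappa> \<nearrow> \<tau>. w \<tau> \<kappa> * f \<tau>)
      + (\<Sum>\<kappa> | \<kappa> \<nearrow> \<tau>. \<Sum>\<sigma> | \<kappa> \<nearrow> \<sigma> \<and> \<sigma> \<noteq> \<tau>. w \<sigma> \<kappa> * f \<sigma>)"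
  proof -
    have "down (up v f) \<tau> =
        (\<Sum>\<kappa> | \<kappa> \<nearrow> \<tau>. w \<tau> \<kappa> * f \<tau> + (\<Sum>\<sigma> | \<kappa> \<nearrow> \<sigma> \<and> \<sigma> \<noteq> \<tau>. w \<sigma> \<kappa> * f \<sigma>))"
      unfolding up_def down_def w_def
      by (intro sum.cong refl) (simp add: split[OF finite_adds_box_above])
    then show ?thesis by (simp add: sum.distrib)
  qed
  \<comment> \<open>Replace the common upper neighbour \<open>D\<close> of \<open>\<tau>\<close> and
    \<open>\<sigma>\<close> by their common lower neighbour \<open>\<tau> \<inter> \<sigma>\<close>;
    the inverse takes the union.\<close>
  have 3: "(\<Sum>D | \<tau> \<nearrow> D. \<Sum>\<sigma> | \<sigma> \<nearrow> D \<and> \<sigma> \<noteq> \<tau>. w D \<tau> * f \<sigma>) =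
      (\<Sum>\<kappa> | \<kappa> \<nearrow> \<tau>. \<Sum>\<sigma> | \<kappa> \<nearrow> \<sigma> \<and> \<sigma> \<noteq> \<tau>. w \<sigma> \<kappa> * f \<sigma>)"
  proof -
    have "(\<Sum>(D, \<sigma>)\<in>(SIGMA D:{D. \<tau> \<nearrow> D}. {\<sigma>. \<sigma> \<nearrow> D \<and> \<sigma> \<noteq> \<tau>}). w D \<tau> * f \<sigma>) =
        (\<Sum>(\<kappa>, \<sigma>)\<in>(SIGMA \<kappa>:{\<kappa>. \<kappa> \<nearrow> \<tau>}. {\<sigma>. \<kappa> \<nearrow> \<sigma> \<and> \<sigma> \<noteq> \<tau>}). w \<sigma> \<kappa> * f \<sigma>)"
    proof (rule sum.reindex_bij_witness[where i = "\<lambda>(\<kappa>, \<sigma>). (\<tau> \<union> \<sigma>, \<sigma>)"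
            and j = "\<lambda>(D, \<sigma>). (\<tau> \<inter> \<sigma>, \<sigma>)"], goal_cases)
      case (1 p)
      then show ?case using adds_box_exchange(3) by (cases p) simp
    next
      case (2 p)
      then show ?case using adds_box_exchange(1,2) by (cases p) (simp, blast)
    next
      case (3 p)
      then show ?case using adds_box_exchange'(3) by (cases p) simp
    next
      case (4 p)
      then show ?case using adds_box_exchange'(1,2) by (cases p) (simp, blast)
    next
      case (5 p)
      then show ?case using adds_box_exchange(4)[of \<tau> "fst p" "snd p"] by (cases p) (simp add: w_def)
    qed
    then show ?thesis
      by (simp add: sum.Sigma finite_adds_box_above finite_adds_box_below fin)
  qed
  have "(\<Sum>D | \<tau> \<nearrow> D. w D \<tau>) - (\<Sum>\<kappa> | \<kappa> \<nearrow> \<tau>. w \<tau> \<kappa>) = v 0 + 2 * card \<tau>"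
    unfolding w_def sum_adds_box_above[OF \<tau>, of "\<lambda>b. v (box_content b)"]
      sum_adds_box_below[OF \<tau>, of "\<lambda>b. v (box_content b)"] sum_corners[OF \<tau>]
    by (simp add: v)
  then have "(\<Sum>D | \<tau> \<nearrow> D. w D \<tau> * f \<tau>) - (\<Sum>\<kappa> | \<kappa> \<nearrow> \<tau>. w \<tau> \<kappa> * f \<tau>) = (v 0 + 2 * card \<tau>) * f \<tau>"
    by (simp flip: sum_distrib_right left_diff_distrib)
  then show ?thesis unfolding 1 2 3 by simp
qed

text \<open>Moving \<open>up v\<close> past the \<open>k\<close> factors one at a time, the crossing
  number j (from 0) takes place j levels lower and contributes
  \<open>v 0 + 2 * (card \<tau> - j)\<close>. Summing over j < k gives the coefficient. It vanishes
  for \<open>k = 0\<close>, where \<open>k - 1\<close> is truncated.\<close>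

lemma up_down_power_commute:
  fixes v :: "int \<Rightarrow> real"
  assumes v: "\<And>c. v (c - 1) + v (c + 1) = 2 * v c + 2" and \<tau>: "young_diagram \<tau>"
  shows "up v ((down ^^ k) f) \<tau> = (down ^^ k) (up v f) \<tau>
    + k * (v 0 + 2 * card \<tau> + 1 - k) * (down ^^ (k - 1)) f \<tau>"
  using \<tau>
proof (induction k arbitrary: \<tau>)
  case (Suc k)
  have "up v ((down ^^ Suc k) f) \<tau> =
      down (up v ((down ^^ k) f)) \<tau> + (v 0 + 2 * card \<tau>) * (down ^^ k) f \<tau>"
    using up_down_commute[OF v Suc.prems] by simp
  also have "down (up v ((down ^^ k) f)) \<tau> = down (\<lambda>\<kappa>. (down ^^ k) (up v f) \<kappa>
      + k * (v 0 + 2 * card \<tau> - 1 - k) * (down ^^ (k - 1)) f \<kappa>) \<tau>"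
    by (intro down_cong) (simp add: Suc.IH adds_box_young adds_box_card)
  also have "\<dots> = (down ^^ Suc k) (up v f) \<tau> + k * (v 0 + 2 * card \<tau> - 1 - k) * (down ^^ k) f \<tau>"
    unfolding down_add down_cmult by (cases k) auto
  finally show ?case by (simp add: algebra_simps)
qed simp

section \<open>Support and positivity of iterated steps\<close>

lemma up_power_eq_0:
  assumes "young_diagram \<tau>" "\<And>D. young_diagram D \<Longrightarrow> \<tau> \<subseteq> D \<Longrightarrow> f D = 0"
  shows "(up v ^^ k) f \<tau> = 0"
  using assms(1) assms(2)
proof (induction k arbitrary: \<tau>)
  case (Suc k)
  have "(up v ^^ k) f D = 0" if "\<tau> \<nearrow> D" for D
    using Suc adds_box_young[OF that] adds_box_insert[OF that] by blast
  then show ?case by (simp add: up_def[of v "(up v ^^ k) f"])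
qed simp

text \<open>A descent of \<open>k\<close> steps from \<open>D\<close> evaluates the function only at
  subdiagrams with \<open>k\<close> boxes fewer.\<close>

lemma down_power_cong:
  assumes "young_diagram D"
    "\<And>\<tau>. young_diagram \<tau> \<Longrightarrow> \<tau> \<subseteq> D \<Longrightarrow> card \<tau> + k = card D \<Longrightarrow> f \<tau> = g \<tau>"
  shows "(down ^^ k) f D = (down ^^ k) g D"
  using assms(1) assms(2)
proof (induction k arbitrary: D)
  case (Suc k)
  have "(down ^^ k) f \<tau> = (down ^^ k) g \<tau>" if "\<tau> \<nearrow> D" for \<tau>
    using Suc.prems adds_box_young[OF that] adds_box_insert[OF that] adds_box_card[OF that]
    by (intro Suc.IH) auto
  then show ?case by (auto intro: down_cong)
qed simp

lemma down_power_0: "(down ^^ k) (\<lambda>_. 0) = (\<lambda>_. 0)"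
  by (induction k) (auto simp: down_def)

lemma down_nonneg: "(\<And>D. 0 \<le> f D) \<Longrightarrow> 0 \<le> (down ^^ k) f D"
  by (induction k arbitrary: D) (auto simp: down_def intro!: sum_nonneg)

lemma up_nonneg: "(\<And>c. 0 \<le> v c) \<Longrightarrow> (\<And>D. 0 \<le> f D) \<Longrightarrow> 0 \<le> (up v ^^ k) f D"
  by (induction k arbitrary: D) (auto simp: up_def intro!: sum_nonneg)

section \<open>Counting standard tableaux\<close>

lemma finite_standard_tableaux:
  assumes "finite D"
  shows "finite (standard_tableaux D)"
proof (rule finite_subset)
  show "standard_tableaux D \<subseteq> D \<rightarrow>\<^sub>E {1..card D}" unfolding standard_tableaux_def by auto
qed (use assms in \<open>auto intro: finite_PiE\<close>)

lemma num_tableaux_empty: "num_tableaux {} = 1"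
proof -
  have "standard_tableaux {} = {\<lambda>_. undefined}"
    unfolding standard_tableaux_def by (auto simp: bij_betw_def)
  then show ?thesis unfolding num_tableaux_def by simp
qed

text \<open>The largest entry goes into the new box. This keeps rows and columns increasing because
  no old box lies to the right of or below the new one: the diagram \<open>\<tau>\<close> would then
  already contain it.\<close>

lemma standard_tableaux_extend:
  assumes D: "\<tau> \<nearrow> D" and t: "t \<in> standard_tableaux \<tau>"
  shows "t(added_box D \<tau> := card D) \<in> standard_tableaux D"
proof -
  define b where "b = added_box D \<tau>"
  define t' where "t' = t(b := card D)"
  have b: "b \<notin> \<tau>" "D = insert b \<tau>" unfolding b_def using adds_box_insert[OF D] .
  have c: "card D = Suc (card \<tau>)" using adds_box_card[OF D] .
  from t have tE: "t \<in> \<tau> \<rightarrow>\<^sub>E {1..card \<tau>}" and bij: "bij_betw t \<tau> {1..card \<tau>}"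
    and row: "\<And>i j j'. (i, j) \<in> \<tau> \<Longrightarrow> (i, j') \<in> \<tau> \<Longrightarrow> j < j' \<Longrightarrow> t (i, j) < t (i, j')"
    and col: "\<And>i i' j. (i, j) \<in> \<tau> \<Longrightarrow> (i', j) \<in> \<tau> \<Longrightarrow> i < i' \<Longrightarrow> t (i, j) < t (i', j)"
    unfolding standard_tableaux_def by auto
  have y: "young_diagram \<tau>" using adds_box_young[OF D] by simp
  have le: "t x < card D" if "x \<in> \<tau>" for x using PiE_mem[OF tE that] c by auto
  have "bij_betw t' \<tau> {1..card \<tau>}"
    using bij b unfolding t'_def by (subst bij_betw_cong[where g = t]) auto
  then have "bij_betw t' (\<tau> \<union> {b}) ({1..card \<tau>} \<union> {card D})"
    using b c unfolding t'_def by (intro bij_betw_combine) (auto simp: bij_betw_def)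
  moreover have "{1..card \<tau>} \<union> {card D} = {1..card D}" unfolding c by auto
  ultimately have bij': "bij_betw t' D {1..card D}" using b by simp
  moreover have "t' \<in> D \<rightarrow>\<^sub>E {1..card D}"
    using tE b bij_betwE[OF bij'] unfolding t'_def PiE_def extensional_def by auto
  moreover have "t' (i, j) < t' (i, j')" if "(i, j) \<in> D" "(i, j') \<in> D" "j < j'" for i j j'
  proof (cases "(i, j') = b")
    case True
    then show ?thesis using that b le unfolding t'_def by auto
  next
    case False
    then have "(i, j') \<in> \<tau>" using that b by auto
    moreover have "(i, j) \<noteq> b"
      using young_diagram_below[OF y \<open>(i, j') \<in> \<tau>\<close>, of i j]
        young_diagram_pos[OF adds_box_young(2)[OF D] that(1)] that b by auto
    ultimately show ?thesis using False that b row unfolding t'_def by auto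
  qed
  moreover have "t' (i, j) < t' (i', j)" if "(i, j) \<in> D" "(i', j) \<in> D" "i < i'" for i i' j
  proof (cases "(i', j) = b")
    case True
    then show ?thesis using that b le unfolding t'_def by auto
  next
    case False
    then have "(i', j) \<in> \<tau>" using that b by auto
    moreover have "(i, j) \<noteq> b"
      using young_diagram_below[OF y \<open>(i', j) \<in> \<tau>\<close>, of i j]
        young_diagram_pos[OF adds_box_young(2)[OF D] that(1)] that b by auto
    ultimately show ?thesis using False that b col unfolding t'_def by auto
  qed
  ultimately show ?thesis unfolding standard_tableaux_def t'_def b_def by blast
qed

text \<open>Nothing can follow the largest entry in its row or column, so its box is a removable
  corner. Resetting the value to \<open>undefined\<close> keeps the filling extensional on the
  smaller diagram.\<close>

lemma standard_tableaux_remove_max: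
  assumes D: "young_diagram D" and t: "t \<in> standard_tableaux D" and b: "b \<in> D" "t b = card D"
  shows "D - {b} \<nearrow> D" "t(b := undefined) \<in> standard_tableaux (D - {b})"
proof -
  obtain k l where kl: "b = (k, l)" by (cases b)
  from t have tE: "t \<in> D \<rightarrow>\<^sub>E {1..card D}" and bij: "bij_betw t D {1..card D}"
    and row: "\<And>i j j'. (i, j) \<in> D \<Longrightarrow> (i, j') \<in> D \<Longrightarrow> j < j' \<Longrightarrow> t (i, j) < t (i, j')"
    and col: "\<And>i i' j. (i, j) \<in> D \<Longrightarrow> (i', j) \<in> D \<Longrightarrow> i < i' \<Longrightarrow> t (i, j) < t (i', j)"
    unfolding standard_tableaux_def by auto
  have fin: "finite D" using young_diagram_finite[OF D] .
  have le: "1 \<le> t x \<and> t x \<le> card D" if "x \<in> D" for x using PiE_mem[OF tE that] by auto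
  have "(Suc k, l) \<notin> D"
    using col[of k l "Suc k"] le[of "(Suc k, l)"] b kl by auto
  moreover have "(k, Suc l) \<notin> D"
    using row[of k l "Suc l"] le[of "(k, Suc l)"] b kl by auto
  ultimately have "b \<in> removable D" using removable_iff[OF D] b kl by simp
  then have y: "young_diagram (D - {b})" unfolding removable_def by simp
  have ins: "insert b (D - {b}) = D" using b by auto
  show "D - {b} \<nearrow> D" using adds_boxI[OF y, of b] D unfolding ins by simp
  have c: "card D = Suc (card (D - {b}))" using b fin by (metis card_Suc_Diff1)
  have "bij_betw t (D - {b}) ({1..card D} - {t b})"
    using bij b le[of b] by (intro bij_betw_DiffI) (auto simp: bij_betw_def)
  moreover have "{1..card D} - {t b} = {1..card (D - {b})}" unfolding b(2) c by auto
  ultimately have "bij_betw t (D - {b}) {1..card (D - {b})}" by simp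
  then have bij': "bij_betw (t(b := undefined)) (D - {b}) {1..card (D - {b})}"
    by (subst bij_betw_cong[where g = t]) auto
  moreover have "t(b := undefined) \<in> (D - {b}) \<rightarrow>\<^sub>E {1..card (D - {b})}"
    using tE bij_betwE[OF bij'] unfolding PiE_def extensional_def by auto
  ultimately show "t(b := undefined) \<in> standard_tableaux (D - {b})"
    using row col unfolding standard_tableaux_def by auto
qed

text \<open>The branching rule: deleting the largest entry is a bijection from the tableaux of
  \<open>D\<close> to pairs of a lower neighbour and a tableau on it, with
  \<open>standard_tableaux_extend\<close> providing the inverse.\<close>

lemma num_tableaux_branching:
  assumes D: "young_diagram D" "D \<noteq> {}"
  shows "num_tableaux D = (\<Sum>\<tau> | \<tau> \<nearrow> D. num_tableaux \<tau>)"
proof -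
  have fin: "finite D" using young_diagram_finite[OF D(1)] .
  have "(\<Sum>\<tau> | \<tau> \<nearrow> D. num_tableaux \<tau>) = card (SIGMA \<tau>:{\<tau>. \<tau> \<nearrow> D}. standard_tableaux \<tau>)"
    unfolding num_tableaux_def
    by (intro card_SigmaI[symmetric] finite_adds_box_below ballI finite_standard_tableaux)
      (auto dest: adds_box_young intro: young_diagram_finite)
  also have "\<dots> = card (standard_tableaux D)"
  proof (rule bij_betw_same_card, rule bij_betw_byWitness)
    let ?f = "\<lambda>(\<tau>, t). t(added_box D \<tau> := card D)"
    let ?b = "\<lambda>t. inv_into D t (card D)"
    let ?g = "\<lambda>t. (D - {?b t}, t(?b t := undefined))"
    have inv: "?b t \<in> D" "t (?b t) = card D" if "t \<in> standard_tableaux D" for t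
    proof -
      have "card D \<in> t ` D"
        using that D fin unfolding standard_tableaux_def bij_betw_def
        by (auto simp: Suc_le_eq card_gt_0_iff)
      then show "?b t \<in> D" "t (?b t) = card D" by (auto intro: inv_into_into f_inv_into_f)
    qed
    show "\<forall>a\<in>(SIGMA \<tau>:{\<tau>. \<tau> \<nearrow> D}. standard_tableaux \<tau>). ?g (?f a) = a"
    proof
      fix a assume "a \<in> (SIGMA \<tau>:{\<tau>. \<tau> \<nearrow> D}. standard_tableaux \<tau>)"
      then obtain \<tau> t where a: "a = (\<tau>, t)" and \<tau>: "\<tau> \<nearrow> D" and t: "t \<in> standard_tableaux \<tau>"
        by auto
      let ?c = "added_box D \<tau>"
      note c = adds_box_insert[OF \<tau>]
      have t': "t(?c := card D) \<in> standard_tableaux D"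
        using standard_tableaux_extend[OF \<tau> t] .
      then have "inj_on (t(?c := card D)) D"
        unfolding standard_tableaux_def bij_betw_def by auto
      then have "?b (t(?c := card D)) = ?c"
        using c by (intro inv_into_f_eq) auto
      moreover have "t ?c = undefined"
        using t c(1) unfolding standard_tableaux_def by (blast intro: PiE_arb)
      ultimately have "?g (t(?c := card D)) = (\<tau>, t)"
        using c by auto
      then show "?g (?f a) = a" unfolding a by simp
    qed
    show "\<forall>t\<in>standard_tableaux D. ?f (?g t) = t"
    proof
      fix t assume t: "t \<in> standard_tableaux D"
      have "added_box D (D - {?b t}) = ?b t"
        using added_box_insert[of "?b t" "D - {?b t}"] inv[OF t] by (simp add: insert_absorb)
      then show "?f (?g t) = t" using inv[OF t] by auto
    qed
    show "?f ` (SIGMA \<tau>:{\<tau>. \<tau> \<nearrow> D}. standard_tableaux \<tau>) \<subseteq> standard_tableaux D"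
      using standard_tableaux_extend by auto
    show "?g ` standard_tableaux D \<subseteq> (SIGMA \<tau>:{\<tau>. \<tau> \<nearrow> D}. standard_tableaux \<tau>)"
    proof (rule image_subsetI)
      fix t assume t: "t \<in> standard_tableaux D"
      show "?g t \<in> (SIGMA \<tau>:{\<tau>. \<tau> \<nearrow> D}. standard_tableaux \<tau>)"
        using standard_tableaux_remove_max[OF D(1) t inv[OF t]] by simp
    qed
  qed
  finally show ?thesis unfolding num_tableaux_def ..
qed

text \<open>A box that maximises \<open>i + j\<close> has no neighbour to the right or below, hence
  is removable.\<close>

lemma ex_adds_box:
  assumes D: "young_diagram D" "D \<noteq> {}"
  shows "\<exists>\<tau>. \<tau> \<nearrow> D"
proof -
  have fin: "finite D" using young_diagram_finite[OF D(1)] .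
  define s where "s = Max ((\<lambda>(i, j). i + j) ` D)"
  have "s \<in> (\<lambda>(i, j). i + j) ` D" unfolding s_def using fin D by (intro Max_in) auto
  then obtain i j where ij: "(i, j) \<in> D" "s = i + j" by auto
  have max: "a + b \<le> s" if "(a, b) \<in> D" for a b
    unfolding s_def using fin that by (intro Max_ge) force+
  have "(i, j) \<in> removable D"
    unfolding removable_iff[OF D(1)] using ij max[of "Suc i" j] max[of i "Suc j"] by auto
  then have "young_diagram (D - {(i, j)})" unfolding removable_def by auto
  moreover have "insert (i, j) (D - {(i, j)}) = D" using ij by auto
  ultimately show ?thesis
    using adds_boxI[of "D - {(i, j)}" "(i, j)"] D by auto
qed

lemma num_tableaux_pos: "young_diagram D \<Longrightarrow> 0 < num_tableaux D"
proof (induction "card D" arbitrary: D)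
  case 0
  then show ?case using young_diagram_finite num_tableaux_empty by auto
next
  case (Suc m)
  then have ne: "D \<noteq> {}" by auto
  obtain \<tau> where \<tau>: "\<tau> \<nearrow> D" using ex_adds_box[OF Suc.prems ne] by blast
  have "0 < num_tableaux \<tau>"
    using Suc adds_box_young[OF \<tau>] adds_box_card[OF \<tau>] by auto
  also have "\<dots> \<le> num_tableaux D"
    unfolding num_tableaux_branching[OF Suc.prems ne]
    using \<tau> finite_adds_box_below by (intro member_le_sum) auto
  finally show ?case .
qed

section \<open>Complete descents and ascents\<close>

lemma partitions_0: "partitions 0 = {{}}"
  unfolding partitions_def using young_diagram_finite young_diagram_empty by auto

text \<open>The descents from \<open>D\<close> to the empty diagram are counted by the standard
  tableaux, through the branching rule.\<close>

lemma down_power_full: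
  fixes f :: "diagram \<Rightarrow> real"
  shows "D \<in> partitions n \<Longrightarrow> (down ^^ n) f D = num_tableaux D * f {}"
proof (induction n arbitrary: D)
  case 0
  then show ?case by (simp add: partitions_0 num_tableaux_empty)
next
  case (Suc n)
  have y: "young_diagram D" and ne: "D \<noteq> {}" using Suc.prems unfolding partitions_def by auto
  have "(down ^^ Suc n) f D = (\<Sum>\<tau> | \<tau> \<nearrow> D. num_tableaux \<tau> * f {})"
    unfolding funpow.simps o_apply down_def[of "(down ^^ n) f"]
    using Suc adds_box_partitions by (intro sum.cong) auto
  also have "\<dots> = num_tableaux D * f {}"
    unfolding num_tableaux_branching[OF y ne] by (simp flip: sum_distrib_right)
  finally show ?case .
qed

abbreviation delta :: "diagram \<Rightarrow> diagram \<Rightarrow> real" where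
  "delta E \<equiv> \<lambda>D. of_bool (D = E)"

text \<open>Expanding in point masses lets the next induction peel off the last box added on the way
  to \<open>E\<close>, rather than the first.\<close>

lemma up_delta:
  "up v (delta E) = (\<lambda>D. \<Sum>\<tau> | \<tau> \<nearrow> E. v (box_content (added_box E \<tau>)) * delta \<tau> D)"
proof
  fix D
  have "up v (delta E) D = (\<Sum>F | D \<nearrow> F. if F = E then v (box_content (added_box E D)) else 0)"
    unfolding up_def by (intro sum.cong) auto
  also have "\<dots> = (if D \<nearrow> E then v (box_content (added_box E D)) else 0)"
    using finite_adds_box_above by simp
  also have "\<dots> = (\<Sum>\<tau> | \<tau> \<nearrow> E. if \<tau> = D then v (box_content (added_box E D)) else 0)"
    using finite_adds_box_below by simp
  also have "\<dots> = (\<Sum>\<tau> | \<tau> \<nearrow> E. v (box_content (added_box E \<tau>)) * delta \<tau> D)"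
    by (intro sum.cong) auto
  finally show "up v (delta E) D = \<dots>" .
qed

text \<open>Every path from the empty diagram to \<open>E\<close> adds each box of \<open>E\<close>
  exactly once, so all paths carry the same weight; their number is
  \<open>num_tableaux E\<close>.\<close>

lemma up_power_delta_full:
  fixes v :: "int \<Rightarrow> real"
  shows
  "E \<in> partitions n \<Longrightarrow> (up v ^^ n) (delta E) {} = num_tableaux E * (\<Prod>b\<in>E. v (box_content b))"
proof (induction n arbitrary: E)
  case 0
  then show ?case by (simp add: partitions_0 num_tableaux_empty)
next
  case (Suc n)
  have y: "young_diagram E" and ne: "E \<noteq> {}" using Suc.prems unfolding partitions_def by auto
  have lin: "(up v ^^ n) (\<lambda>D. \<Sum>i\<in>I. c i * f i D) = (\<lambda>D. \<Sum>i\<in>I. c i * (up v ^^ n) (f i) D)"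
    for n and I :: "diagram set" and c f
    by (induction n) (simp_all add: up_sum up_cmult)
  have "(up v ^^ Suc n) (delta E) {} =
      (\<Sum>\<tau> | \<tau> \<nearrow> E. v (box_content (added_box E \<tau>)) * (up v ^^ n) (delta \<tau>) {})"
    unfolding funpow_Suc_right o_apply up_delta lin ..
  also have "\<dots> = (\<Sum>\<tau> | \<tau> \<nearrow> E. num_tableaux \<tau> * (\<Prod>b\<in>E. v (box_content b)))"
  proof (intro sum.cong refl)
    fix \<tau> assume "\<tau> \<in> {\<tau>. \<tau> \<nearrow> E}"
    then have \<tau>: "\<tau> \<nearrow> E" by simp
    have "(\<Prod>b\<in>E. v (box_content b)) = v (box_content (added_box E \<tau>)) * (\<Prod>b\<in>\<tau>. v (box_content b))"
      using adds_box_insert[OF \<tau>] adds_box_young[OF \<tau>] young_diagram_finite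
      by (metis prod.insert)
    moreover have "(up v ^^ n) (delta \<tau>) {} = num_tableaux \<tau> * (\<Prod>b\<in>\<tau>. v (box_content b))"
      using Suc \<tau> adds_box_partitions by auto
    ultimately show "v (box_content (added_box E \<tau>)) * (up v ^^ n) (delta \<tau>) {} =
        num_tableaux \<tau> * (\<Prod>b\<in>E. v (box_content b))" by simp
  qed
  also have "\<dots> = num_tableaux E * (\<Prod>b\<in>E. v (box_content b))"
    unfolding num_tableaux_branching[OF y ne] by (simp flip: sum_distrib_right)
  finally show ?case .
qed

section \<open>The birth chain and sums of geometric variables\<close>

text \<open>For rates in [0, 1], the probability that the pure birth chain started in 0, which moves
  from \<open>k\<close> to \<open>Suc k\<close> with probability \<open>p k\<close>, is in state
  \<open>k\<close> at time \<open>r\<close>.\<close>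

primrec birth :: "(nat \<Rightarrow> real) \<Rightarrow> nat \<Rightarrow> nat \<Rightarrow> real" where
  "birth p 0 k = (if k = 0 then 1 else 0)"
| "birth p (Suc r) k =
    (1 - p k) * birth p r k + (case k of 0 \<Rightarrow> 0 | Suc j \<Rightarrow> p j * birth p r j)"

lemma birth_nonneg:
  assumes "\<And>j. j \<le> k \<Longrightarrow> p j \<in> {0..1}"
  shows "0 \<le> birth p r k"
  using assms by (induction r arbitrary: k) (auto split: nat.split)

text \<open>Mass leaves the states up to \<open>m\<close> only by the jump out of
  \<open>m\<close>.\<close>

lemma birth_sum_Suc:
  "(\<Sum>k\<le>m. birth p (Suc r) k) = (\<Sum>k\<le>m. birth p r k) - p m * birth p r m"
  by (induction m) (auto simp: algebra_simps)

lemma birth_total: "p m = 0 \<Longrightarrow> (\<Sum>k\<le>m. birth p r k) = 1"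
  by (induction r) (auto simp only: birth_sum_Suc, auto simp: sum.atMost_shift)

section \<open>Sums of independent geometric variables\<close>

context prob_space
begin

lemma geometric_rv_0:
  assumes X: "geometric_rv M p X" and p: "p \<in> {0<..1}"
  shows "prob {\<omega> \<in> space M. X \<omega> = 0} = 0"
proof -
  have [measurable]: "X \<in> measurable M (count_space UNIV)"
    and val: "\<And>m. prob {\<omega> \<in> space M. X \<omega> = Suc m} = p * (1 - p) ^ m"
    using X unfolding geometric_rv_def by auto
  have "(\<lambda>m. prob {\<omega> \<in> space M. X \<omega> = m}) sums prob (\<Union>m. {\<omega> \<in> space M. X \<omega> = m})"
    by (intro finite_measure_UNION) (auto simp: disjoint_family_on_def)
  moreover have "(\<Union>m. {\<omega> \<in> space M. X \<omega> = m}) = space M" by auto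
  ultimately have "(\<lambda>m. prob {\<omega> \<in> space M. X \<omega> = m}) sums 1"
    by (simp add: prob_space)
  moreover have "(\<lambda>m. prob {\<omega> \<in> space M. X \<omega> = Suc m}) sums 1"
  proof -
    have "(\<lambda>m. p * (1 - p) ^ m) sums (p * (1 / (1 - (1 - p))))"
      using p by (intro sums_mult geometric_sums) auto
    then show ?thesis using p unfolding val by simp
  qed
  ultimately show ?thesis
    using sums_Suc[of "\<lambda>m. prob {\<omega> \<in> space M. X \<omega> = m}" 1] sums_unique2 by fastforce
qed

lemma prob_sum_le:
  fixes S X :: "'a \<Rightarrow> nat"
  assumes ind: "indep_var (count_space UNIV) S (count_space UNIV) X"
  shows "prob {\<omega> \<in> space M. S \<omega> + X \<omega> \<le> r} =
    (\<Sum>m\<le>r. prob {\<omega> \<in> space M. X \<omega> = m} * prob {\<omega> \<in> space M. S \<omega> \<le> r - m})"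
proof -
  have [measurable]: "S \<in> measurable M (count_space UNIV)" "X \<in> measurable M (count_space UNIV)"
    using indep_var_rv1[OF ind] indep_var_rv2[OF ind] .
  have "{\<omega> \<in> space M. S \<omega> + X \<omega> \<le> r} =
      (\<Union>m\<in>{..r}. {\<omega> \<in> space M. X \<omega> = m \<and> S \<omega> \<le> r - m})" by auto
  also have "prob \<dots> = (\<Sum>m\<le>r. prob {\<omega> \<in> space M. X \<omega> = m \<and> S \<omega> \<le> r - m})"
    by (intro finite_measure_finite_Union) (auto simp: disjoint_family_on_def)
  also have "\<dots> = (\<Sum>m\<le>r. prob {\<omega> \<in> space M. X \<omega> = m} * prob {\<omega> \<in> space M. S \<omega> \<le> r - m})"
  proof (intro sum.cong refl)
    fix m
    have "prob ((\<lambda>\<omega>. (S \<omega>, X \<omega>)) -` ({..r - m} \<times> {m}) \<inter> space M) =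
        prob (S -` {..r - m} \<inter> space M) * prob (X -` {m} \<inter> space M)"
      by (rule indep_varD[OF ind]) auto
    moreover have "(\<lambda>\<omega>. (S \<omega>, X \<omega>)) -` ({..r - m} \<times> {m}) \<inter> space M =
        {\<omega> \<in> space M. X \<omega> = m \<and> S \<omega> \<le> r - m}" by auto
    moreover have "S -` {..r - m} \<inter> space M = {\<omega> \<in> space M. S \<omega> \<le> r - m}"
      "X -` {m} \<inter> space M = {\<omega> \<in> space M. X \<omega> = m}" by auto
    ultimately show "prob {\<omega> \<in> space M. X \<omega> = m \<and> S \<omega> \<le> r - m} =
        prob {\<omega> \<in> space M. X \<omega> = m} * prob {\<omega> \<in> space M. S \<omega> \<le> r - m}" by simp
  qed
  finally show ?thesis .
qed

text \<open>Condition on the first trial of \<open>X\<close>. With probability \<open>p\<close> it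
  succeeds and \<open>X\<close> is 1; otherwise \<open>X - 1\<close> again has the law of
  \<open>X\<close>. In the proof this is the shift of the convolution sum by one index.\<close>

lemma prob_sum_geometric_le:
  fixes S X :: "'a \<Rightarrow> nat"
  assumes ind: "indep_var (count_space UNIV) S (count_space UNIV) X"
    and X: "geometric_rv M p X" and p: "p \<in> {0<..1}"
  shows "prob {\<omega> \<in> space M. S \<omega> + X \<omega> \<le> 0} = 0"
    and "prob {\<omega> \<in> space M. S \<omega> + X \<omega> \<le> Suc r} =
      p * prob {\<omega> \<in> space M. S \<omega> \<le> r} + (1 - p) * prob {\<omega> \<in> space M. S \<omega> + X \<omega> \<le> r}"
proof -
  define q where "q m = prob {\<omega> \<in> space M. X \<omega> = m}" for m
  define g where "g m = prob {\<omega> \<in> space M. S \<omega> \<le> m}" for m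
  have q0: "q 0 = 0" unfolding q_def by (rule geometric_rv_0[OF X p])
  have q: "q (Suc m) = p * (1 - p) ^ m" for m
    using X unfolding geometric_rv_def q_def by simp
  have conv: "prob {\<omega> \<in> space M. S \<omega> + X \<omega> \<le> r} = (\<Sum>m\<le>r. q m * g (r - m))" for r
    unfolding q_def g_def by (rule prob_sum_le[OF ind])
  show "prob {\<omega> \<in> space M. S \<omega> + X \<omega> \<le> 0} = 0"
    unfolding conv by (simp add: q0)
  have "(\<Sum>m\<le>Suc r. q m * g (Suc r - m)) = (\<Sum>m\<le>r. q (Suc m) * g (r - m))"
    unfolding sum.atMost_shift[of _ "Suc r"] by (simp add: q0 lessThan_Suc_atMost)
  also have "\<dots> = p * g r + (\<Sum>m<r. (1 - p) * (q (Suc m) * g (r - Suc m)))"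
    unfolding sum.atMost_shift[of _ r] by (simp add: q mult_ac)
  also have "\<dots> = p * g r + (1 - p) * (\<Sum>m\<le>r. q m * g (r - m))"
    unfolding sum.atMost_shift[of _ r] by (simp add: q0 sum_distrib_left)
  finally show "prob {\<omega> \<in> space M. S \<omega> + X \<omega> \<le> Suc r} =
      p * prob {\<omega> \<in> space M. S \<omega> \<le> r} + (1 - p) * prob {\<omega> \<in> space M. S \<omega> + X \<omega> \<le> r}"
    unfolding conv g_def .
qed

lemma indep_vars_partial_sum:
  fixes X :: "nat \<Rightarrow> 'a \<Rightarrow> nat"
  assumes "indep_vars (\<lambda>_. count_space UNIV) X {..<N}" "j < N"
  shows "indep_var (count_space UNIV) (\<lambda>\<omega>. \<Sum>i<j. X i \<omega>) (count_space UNIV) (X j)"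
proof -
  have "indep_var (count_space UNIV) ((\<lambda>f. \<Sum>i<j. f i) \<circ> (\<lambda>\<omega>. restrict (\<lambda>i. X i \<omega>) {..<j}))
      (count_space UNIV) ((\<lambda>f. f j) \<circ> (\<lambda>\<omega>. restrict (\<lambda>i. X i \<omega>) {j}))"
  proof (rule indep_var_compose[OF indep_var_restrict[OF assms(1)]])
    show "(\<lambda>f. \<Sum>i<j. f i) \<in> measurable (Pi\<^sub>M {..<j} (\<lambda>_. count_space UNIV :: nat measure)) (count_space UNIV)"
      by (intro measurable_sum_nat measurable_component_singleton)
  qed (use assms(2) in auto)
  then show ?thesis by (simp add: o_def)
qed

text \<open>The partial sum is distributed like the time at which the birth chain reaches
  \<open>j\<close>. No coupling is built: both sides satisfy the same recursion in \<open>r\<close>,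
  by \<open>prob_sum_geometric_le\<close> and \<open>birth_sum_Suc\<close>. The induction on
  \<open>r\<close> is nested in the one on \<open>j\<close>, whose hypothesis is used at every
  time.\<close>

lemma prob_geometric_sum_le:
  fixes X :: "nat \<Rightarrow> 'a \<Rightarrow> nat"
  assumes ind: "indep_vars (\<lambda>_. count_space UNIV) X {..<N}"
    and X: "\<And>i. i < N \<Longrightarrow> geometric_rv M (p i) (X i)"
    and p: "\<And>i. i < N \<Longrightarrow> p i \<in> {0<..1}"
    and "j \<le> N"
  shows "prob {\<omega> \<in> space M. (\<Sum>i<j. X i \<omega>) \<le> r} = 1 - (\<Sum>k<j. birth p r k)"
  using \<open>j \<le> N\<close>
proof (induction j arbitrary: r)
  case 0
  then show ?case by (simp add: prob_space)
next
  case (Suc j)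
  then have j: "j < N" by simp
  have IH: "prob {\<omega> \<in> space M. (\<Sum>i<j. X i \<omega>) \<le> r} = 1 - (\<Sum>k<j. birth p r k)" for r
    using Suc.IH j by simp
  note step = prob_sum_geometric_le[OF indep_vars_partial_sum[OF ind j] X[OF j] p[OF j]]
  show ?case
  proof (induction r)
    case 0
    have "(\<Sum>k<Suc j. birth p 0 k) = 1"
      unfolding lessThan_Suc_atMost sum.atMost_shift by simp
    then show ?case using step(1) by (simp only: sum.lessThan_Suc diff_self)
  next
    case (Suc r)
    have "prob {\<omega> \<in> space M. (\<Sum>i<Suc j. X i \<omega>) \<le> Suc r} =
        p j * (1 - (\<Sum>k<j. birth p r k)) + (1 - p j) * (1 - (\<Sum>k\<le>j. birth p r k))"
      using step(2)[of r] Suc IH[of r] by (simp only: sum.lessThan_Suc flip: lessThan_Suc_atMost)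
    also have "\<dots> = 1 - (\<Sum>k\<le>j. birth p (Suc r) k)"
      unfolding birth_sum_Suc by (simp add: algebra_simps flip: lessThan_Suc_atMost)
    finally show ?case by (simp only: lessThan_Suc_atMost)
  qed
qed

end

section \<open>Powers of the down-up chain\<close>

definition box_weight :: "complex \<Rightarrow> complex \<Rightarrow> int \<Rightarrow> real" where
  "box_weight z z' c = Re ((z + of_int c) * (z' + of_int c))"

text \<open>The weight is a monic quadratic polynomial in the content.\<close>

lemma box_weight_second_difference:
  "box_weight z z' (c - 1) + box_weight z z' (c + 1) = 2 * box_weight z z' c + 2"
  unfolding box_weight_def by (simp add: algebra_simps)

text \<open>Reduces the positivity of the weight at any content to that of z z'.\<close>

lemma admissible_params_shift:
  assumes "admissible_params z z'"
  shows "admissible_params (z + of_int c) (z' + of_int c)"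
  using assms unfolding admissible_params_def
proof (elim disjE exE conjE)
  assume "z \<notin> \<real>" "z' = cnj z"
  then show "(z + of_int c \<notin> \<real> \<and> z' + of_int c = cnj (z + of_int c)) \<or>
     (\<exists>x y m. z + of_int c = of_real x \<and> z' + of_int c = of_real y \<and>
        of_int m < x \<and> x < of_int m + 1 \<and> of_int m < y \<and> y < of_int m + 1)"
    by (auto simp: complex_is_Real_iff)
next
  fix x y :: real and m :: int
  assume "z = of_real x" "z' = of_real y"
    and "of_int m < x" "x < of_int m + 1" "of_int m < y" "y < of_int m + 1"
  then show "(z + of_int c \<notin> \<real> \<and> z' + of_int c = cnj (z + of_int c)) \<or>
     (\<exists>x y m. z + of_int c = of_real x \<and> z' + of_int c = of_real y \<and>
        of_int m < x \<and> x < of_int m + 1 \<and> of_int m < y \<and> y < of_int m + 1)"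
    by (intro disjI2 exI[of _ "x + of_int c"] exI[of _ "y + of_int c"] exI[of _ "m + c"]) auto
qed

lemma box_weight_pos: "admissible_params z z' \<Longrightarrow> 0 < box_weight z z' c"
  unfolding box_weight_def by (intro admissible_mult_pos admissible_params_shift)

lemma box_weight_eq:
  "admissible_params z z' \<Longrightarrow>
    (z + of_int c) * (z' + of_int c) = complex_of_real (box_weight z z' c)"
  unfolding box_weight_def by (rule of_real_Re[symmetric], rule admissible_real)

lemma z_measure_real:
  assumes "admissible_params z z'"
  shows "z_measure z z' n D = (\<Prod>b\<in>D. box_weight z z' (box_content b)) * num_tableaux D ^ 2
    / (fact n * pochhammer (box_weight z z' 0) n)"
proof -
  have t: "z * z' = complex_of_real (box_weight z z' 0)"
    using box_weight_eq[OF assms, of 0] by simp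
  have "complex_of_real (z_measure z z' n D) = complex_of_real
      ((\<Prod>b\<in>D. box_weight z z' (box_content b)) * num_tableaux D ^ 2
        / (fact n * pochhammer (box_weight z z' 0) n))"
    unfolding z_measure_eq[OF assms] box_weight_eq[OF assms] t
    by (simp add: pochhammer_of_real)
  then show ?thesis using of_real_eq_iff by blast
qed

lemma down_up_real:
  assumes "admissible_params z z'"
  shows "down_up z z' n D E = num_tableaux E / (num_tableaux D * (n * (box_weight z z' 0 + n - 1)))
    * (\<Sum>\<tau> | \<tau> \<in> partitions (n - 1) \<and> \<tau> \<nearrow> D \<and> \<tau> \<nearrow> E.
        box_weight z z' (box_content (added_box E \<tau>)))"
proof -
  have t: "z * z' = complex_of_real (box_weight z z' 0)"
    using box_weight_eq[OF assms, of 0] by simp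
  have "complex_of_real (down_up z z' n D E) = complex_of_real
      (num_tableaux E / (num_tableaux D * (n * (box_weight z z' 0 + n - 1)))
    * (\<Sum>\<tau> | \<tau> \<in> partitions (n - 1) \<and> \<tau> \<nearrow> D \<and> \<tau> \<nearrow> E.
        box_weight z z' (box_content (added_box E \<tau>))))"
    unfolding down_up_eq[OF assms] box_weight_eq[OF assms] t
    by (simp add: mult_ac flip: sum_divide_distrib)
  then show ?thesis using of_real_eq_iff by blast
qed

section \<open>Birth rates and the expansion of the powers\<close>

definition birth_rate :: "real \<Rightarrow> nat \<Rightarrow> nat \<Rightarrow> real" where
  "birth_rate t n k = (real n - real k) * (t + real n - real k - 1) / (n * (t + n - 1))"

lemma birth_rate_bounds:
  assumes "0 < t" "k \<le> n"
  shows "birth_rate t n k \<in> {0..1}"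
\<comment> \<open>For \<open>k = n\<close> the second factor is \<open>t - 1\<close>, which may be
  negative, but the first factor is 0. This zero also makes \<open>n\<close> absorbing.\<close>
proof (cases "k = n")
  case True
  then show ?thesis by (simp add: birth_rate_def)
next
  case False
  then have k: "real k + 1 \<le> real n" using assms by simp
  have "0 < real n * (t + real n - 1)"
    using k assms by (intro mult_pos_pos) auto
  moreover have "0 \<le> (real n - real k) * (t + real n - real k - 1)"
    using k assms by (intro mult_nonneg_nonneg) auto
  moreover have "(real n - real k) * (t + real n - real k - 1) \<le> real n * (t + real n - 1)"
    using k assms by (intro mult_mono) auto
  ultimately show ?thesis unfolding birth_rate_def by simp
qed

lemma geom_param_birth_rate:
  assumes "admissible_params z z'" "n \<ge> 1"
  shows "geom_param z z' n i = birth_rate (box_weight z z' 0) n i"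
proof -
  define t where "t = box_weight z z' 0"
  have t: "z * z' = complex_of_real t" "0 < t"
    unfolding t_def using box_weight_eq[OF assms(1), of 0] box_weight_pos[OF assms(1)] by simp_all
  have "complex_of_real (geom_param z z' n i) = complex_of_real
      (1 - real i / real n * ((t + 2 * real n - real i - 1) / (t + real n - 1)))"
    unfolding geom_param_eq[OF assms(1)] t(1) by simp
  then have "geom_param z z' n i =
      1 - real i / real n * ((t + 2 * real n - real i - 1) / (t + real n - 1))"
    using of_real_eq_iff by blast
  also have "\<dots> = birth_rate t n i"
  proof -
    have "0 < t + real n - 1" "0 < real n" using t(2) assms(2) by auto
    then show ?thesis
      unfolding birth_rate_def by (simp add: divide_simps) (simp add: algebra_simps)
  qed
  finally show ?thesis unfolding t_def .
qed

text \<open>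
  Conjugated by the number of tableaux, \<open>down_up_steps v n k\<close> is the stochastic kernel that
  removes \<open>k\<close> boxes from a diagram of size \<open>n\<close> and then adds \<open>k\<close> boxes.
\<close>

definition down_up_steps :: "(int \<Rightarrow> real) \<Rightarrow> nat \<Rightarrow> nat \<Rightarrow> (diagram \<Rightarrow> real) \<Rightarrow> diagram \<Rightarrow> real" where
  "down_up_steps v n k f D = (down ^^ k) ((up v ^^ k) f) D
    / (\<Prod>j<k. (real n - real j) * (v 0 + real n - real j - 1))"

lemma down_power_eq_0:
  assumes "young_diagram D" "card D < k"
  shows "(down ^^ k) f D = 0"
  using down_power_cong[OF assms(1), of k f "\<lambda>_. 0"] assms(2) by (simp add: down_power_0)

text \<open>Commuting \<open>up v\<close> past the \<open>k\<close> removals produces one term with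
  \<open>k + 1\<close> removals and additions and one with \<open>k\<close> of each. After
  normalisation their coefficients are the birth rate and its complement.\<close>

lemma down_up_step:
  assumes v: "\<And>c. v (c - 1) + v (c + 1) = 2 * v c + 2" and v0: "0 < v 0"
    and D: "D \<in> partitions n" and n: "n \<ge> 1" and k: "k \<le> n"
  shows "down (up v (down_up_steps v n k f)) D = n * (v 0 + n - 1) *
    (birth_rate (v 0) n k * down_up_steps v n (Suc k) f D
      + (1 - birth_rate (v 0) n k) * down_up_steps v n k f D)"
proof -
  define g where "g = (up v ^^ k) f"
  define Z where "Z k = (\<Prod>j<k. (real n - real j) * (v 0 + real n - real j - 1))" for k
  define N where "N = n * (v 0 + n - 1)"
  have N: "0 < N" unfolding N_def using v0 n by (intro mult_pos_pos) auto
  have y: "young_diagram D" and c: "card D = n" using D unfolding partitions_def by auto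
  \<comment> \<open>The commutation takes place at diagrams with \<open>n - 1\<close> boxes, which
    gives the coefficient \<open>v 0 + 2 * (n - 1) + 1 - k\<close>.\<close>
  have "down (up v ((down ^^ k) g)) D = down (\<lambda>\<tau>. (down ^^ k) (up v g) \<tau>
      + k * (v 0 + 2 * n - k - 1) * (down ^^ (k - 1)) g \<tau>) D"
    using c by (intro down_cong)
      (use adds_box_young adds_box_card in \<open>force simp: up_down_power_commute[of v, OF v]\<close>)
  also have "\<dots> = (down ^^ Suc k) (up v g) D + k * (v 0 + 2 * n - k - 1) * (down ^^ k) g D"
    unfolding down_add down_cmult by (cases k) auto
  finally have comm: "down (up v ((down ^^ k) g)) D = \<dots>" .
  have "down_up_steps v n k f = (\<lambda>D. 1 / Z k * (down ^^ k) g D)"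
    unfolding down_up_steps_def Z_def g_def by auto
  then have "down (up v (down_up_steps v n k f)) D = 1 / Z k * down (up v ((down ^^ k) g)) D"
    by (simp only: up_cmult down_cmult)
  also have "\<dots> = (down ^^ Suc k) (up v g) D / Z k
      + k * (v 0 + 2 * n - k - 1) * down_up_steps v n k f D"
    unfolding comm by (simp add: down_up_steps_def Z_def g_def add_divide_distrib)
  also have "k * (v 0 + 2 * n - k - 1) = N * (1 - birth_rate (v 0) n k)"
    unfolding birth_rate_def N_def[symmetric] using N
    by (simp add: field_simps) (simp add: N_def algebra_simps)
  also have "(down ^^ Suc k) (up v g) D / Z k = N * birth_rate (v 0) n k * down_up_steps v n (Suc k) f D"
  \<comment> \<open>For \<open>k = n\<close> the normalising product \<open>Z (Suc k)\<close> is 0.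
    There both sides vanish instead: \<open>n + 1\<close> boxes cannot be removed, and the rate is
    0.\<close>
  proof (cases "k = n")
    case True
    then show ?thesis using down_power_eq_0[OF y, of "Suc k"] c by (simp add: birth_rate_def del: funpow.simps)
  next
    case False
    then have "real k + 1 \<le> real n" using k by simp
    then have nz: "real n - real k \<noteq> 0" "v 0 + real n - real k - 1 \<noteq> 0" using v0 by auto
    have "Z (Suc k) = Z k * ((real n - real k) * (v 0 + real n - real k - 1))"
      unfolding Z_def by simp
    moreover have "N * birth_rate (v 0) n k = (real n - real k) * (v 0 + real n - real k - 1)"
      unfolding birth_rate_def N_def[symmetric] using N by simp
    moreover have "down_up_steps v n (Suc k) f D = (down ^^ Suc k) (up v g) D / Z (Suc k)"
      unfolding down_up_steps_def Z_def g_def by simp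
    ultimately show ?thesis using nz by (simp del: funpow.simps)
  qed
  finally show ?thesis unfolding N_def[symmetric] by (simp add: algebra_simps)
qed

text \<open>A step down and up stays on level \<open>n\<close>, so an identity known only on that
  level may be used under the operators.\<close>

lemma down_up_cong:
  assumes "D \<in> partitions n" "\<And>E. E \<in> partitions n \<Longrightarrow> f E = g E"
  shows "down (up v f) D = down (up v g) D"
proof (intro down_cong up_cong)
  fix \<tau> E assume "\<tau> \<nearrow> D" "\<tau> \<nearrow> E"
  then show "f E = g E"
    using assms adds_box_young adds_box_card unfolding partitions_def by simp
qed

text \<open>By \<open>down_up_step\<close>, a further step of the chain passes weight from
  \<open>k\<close> to \<open>Suc k\<close> exactly as \<open>birth\<close> does. The power in front
  is the normalisation of the chain, which \<open>down\<close> and \<open>up\<close> omit.\<close>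

lemma down_up_power:
  assumes v: "\<And>c. v (c - 1) + v (c + 1) = 2 * v c + 2" and v0: "0 < v 0"
    and n: "n \<ge> 1" and D: "D \<in> partitions n"
  shows "((down \<circ> up v) ^^ r) f D = (n * (v 0 + n - 1)) ^ r *
    (\<Sum>k\<le>n. birth (birth_rate (v 0) n) r k * down_up_steps v n k f D)"
  using D
proof (induction r arbitrary: D)
  case 0
  have "(\<Sum>k\<le>n. birth (birth_rate (v 0) n) 0 k * down_up_steps v n k f D) =
      (\<Sum>k\<le>n. if k = 0 then down_up_steps v n 0 f D else 0)"
    by (intro sum.cong) auto
  then show ?case by (simp add: down_up_steps_def)
next
  case (Suc r)
  define N where "N = n * (v 0 + n - 1)"
  define p where "p = birth_rate (v 0) n"
  define W where "W k = down_up_steps v n k f" for k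
  note IH = Suc.IH[folded N_def p_def W_def]
  have "((down \<circ> up v) ^^ Suc r) f D = down (up v (((down \<circ> up v) ^^ r) f)) D" by simp
  also have "\<dots> = down (up v (\<lambda>D. N ^ r * (\<Sum>k\<le>n. birth p r k * W k D))) D"
    by (rule down_up_cong[OF Suc.prems]) (rule IH)
  also have "\<dots> = N ^ r * (\<Sum>k\<le>n. birth p r k * down (up v (W k)) D)"
    by (simp only: up_cmult up_sum down_cmult down_sum)
  also have "(\<Sum>k\<le>n. birth p r k * down (up v (W k)) D) =
      (\<Sum>k\<le>n. N * (birth p r k * p k * W (Suc k) D + (1 - p k) * birth p r k * W k D))"
    unfolding W_def
    by (intro sum.cong refl, subst down_up_step[OF v v0 Suc.prems n])
      (auto simp: N_def p_def algebra_simps)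
  also have "\<dots> = N * ((\<Sum>k\<le>n. birth p r k * p k * W (Suc k) D)
      + (\<Sum>k\<le>n. (1 - p k) * birth p r k * W k D))"
    by (simp add: sum.distrib flip: sum_distrib_left)
  \<comment> \<open>The term \<open>k = n\<close> drops out since \<open>p n = 0\<close>; the others
    are then reindexed by \<open>Suc k\<close>.\<close>
  also have "(\<Sum>k\<le>n. birth p r k * p k * W (Suc k) D) = (\<Sum>k<n. birth p r k * p k * W (Suc k) D)"
    unfolding lessThan_Suc_atMost[symmetric] by (simp add: p_def birth_rate_def)
  also have "\<dots> = (\<Sum>k\<le>n. (case k of 0 \<Rightarrow> 0 | Suc j \<Rightarrow> p j * birth p r j) * W k D)"
    unfolding sum.atMost_shift by (simp add: mult_ac)
  also have "\<dots> + (\<Sum>k\<le>n. (1 - p k) * birth p r k * W k D) = (\<Sum>k\<le>n. birth p (Suc r) k * W k D)"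
    by (simp add: algebra_simps flip: sum.distrib)
  finally show ?case unfolding N_def p_def W_def by simp
qed

text \<open>The ratios of numbers of tableaux telescope along a path, so only those of the two ends
  survive. The point mass at \<open>E\<close> reads off the matrix entry.\<close>

lemma kernel_power_down_up:
  assumes adm: "admissible_params z z'" and n: "n \<ge> 1"
    and E: "E \<in> partitions n" and D: "D \<in> partitions n"
  shows "kernel_power (partitions n) (down_up z z' n) r D E = num_tableaux E / num_tableaux D *
    ((down \<circ> up (box_weight z z')) ^^ r) (delta E) D / (n * (box_weight z z' 0 + n - 1)) ^ r"
  using D
proof (induction r arbitrary: D)
  case 0
  then show ?case using num_tableaux_pos[of E] partitions_young[OF E] by auto
next
  case (Suc r)
  define N where "N = n * (box_weight z z' 0 + n - 1)"
  define F where "F = ((down \<circ> up (box_weight z z')) ^^ r) (delta E)"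
  define w where "w G \<tau> = box_weight z z' (box_content (added_box G \<tau>))" for G \<tau>
  \<comment> \<open>The size restriction on \<open>\<tau>\<close> in the kernel follows from
    \<open>\<tau> \<nearrow> D\<close>; \<open>above\<close> does the same for the diagrams over
    \<open>\<tau>\<close>, so that the double sum can be swapped.\<close>
  have below: "{\<tau>. \<tau> \<in> partitions (n - 1) \<and> \<tau> \<nearrow> D \<and> \<tau> \<nearrow> G} = {\<tau> \<in> {\<tau>. \<tau> \<nearrow> D}. \<tau> \<nearrow> G}" for G
    using adds_box_partitions[of _ D "n - 1"] Suc.prems n by auto
  have above: "{G \<in> partitions n. \<tau> \<nearrow> G} = {G. \<tau> \<nearrow> G}" if "\<tau> \<nearrow> D" for \<tau>
    using adds_box_partitions[of \<tau> _ "n - 1"] that Suc.prems n by auto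
  have "kernel_power (partitions n) (down_up z z' n) (Suc r) D E =
      (\<Sum>G\<in>partitions n. num_tableaux E / num_tableaux D / N ^ Suc r
        * ((\<Sum>\<tau> | \<tau> \<in> {\<tau>. \<tau> \<nearrow> D} \<and> \<tau> \<nearrow> G. w G \<tau> * F G)))"
    unfolding kernel_power.simps
  proof (intro sum.cong refl)
    fix G assume G: "G \<in> partitions n"
    have "num_tableaux G \<noteq> 0" using num_tableaux_pos[OF partitions_young[OF G]] by simp
    then show "down_up z z' n D G * kernel_power (partitions n) (down_up z z' n) r G E =
        num_tableaux E / num_tableaux D / N ^ Suc r
        * ((\<Sum>\<tau> | \<tau> \<in> {\<tau>. \<tau> \<nearrow> D} \<and> \<tau> \<nearrow> G. w G \<tau> * F G))"
      unfolding down_up_real[OF adm] below Suc.IH[OF G] F_def[symmetric] N_def[symmetric]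
        w_def[symmetric] sum_distrib_right[symmetric] by simp
  qed
  also have "\<dots> = num_tableaux E / num_tableaux D / N ^ Suc r *
      (\<Sum>G\<in>partitions n. (\<Sum>\<tau> | \<tau> \<in> {\<tau>. \<tau> \<nearrow> D} \<and> \<tau> \<nearrow> G. w G \<tau> * F G))"
    by (rule sum_distrib_left[symmetric])
  also have "(\<Sum>G\<in>partitions n. (\<Sum>\<tau> | \<tau> \<in> {\<tau>. \<tau> \<nearrow> D} \<and> \<tau> \<nearrow> G. w G \<tau> * F G)) =
      (\<Sum>\<tau> | \<tau> \<nearrow> D. (\<Sum>G | G \<in> partitions n \<and> \<tau> \<nearrow> G. w G \<tau> * F G))"
    by (rule sum.swap_restrict[OF finite_partitions finite_adds_box_below])
  also have "\<dots> = down (up (box_weight z z') F) D"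
    unfolding down_def up_def w_def using above by (intro sum.cong) auto
  finally show ?case unfolding F_def N_def by (simp add: o_def)
qed

section \<open>Diagrams with one box and the complete down-up step\<close>

lemma partitions_1: "partitions 1 = {{(1, 1)}}"
proof -
  have "D = {(1, 1)}" if "young_diagram D" "card D = 1" for D
  proof -
    have "D \<subseteq> {(1, 1)}" using young_diagram_subset_square[OF that(1)] that(2) by auto
    moreover have "D \<noteq> {}" using that(2) by auto
    ultimately show ?thesis by blast
  qed
  then have "partitions 1 \<subseteq> {{(1, 1)}}" unfolding partitions_def by blast
  moreover have "{(1, 1)} \<in> partitions 1" unfolding partitions_def young_diagram_def by auto
  ultimately show ?thesis by blast
qed

lemma empty_adds_box: "{} \<nearrow> D \<longleftrightarrow> D = {(1, 1)}"
proof
  assume D: "{} \<nearrow> D"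
  have "D \<in> partitions 1"
    unfolding partitions_def using adds_box_young(2)[OF D] adds_box_card[OF D] by simp
  then show "D = {(1, 1)}" unfolding partitions_1 by (rule singletonD)
next
  have "young_diagram {(1, 1)}" by (rule partitions_young[of _ 1]) (unfold partitions_1, rule singletonI)
  moreover assume "D = {(1, 1)}"
  ultimately show "{} \<nearrow> D"
    using adds_boxI[OF young_diagram_empty, of "(1, 1)"] by simp
qed

lemma adds_box_singleton: "\<tau> \<nearrow> {(1, 1)} \<longleftrightarrow> \<tau> = {}"
proof
  assume \<tau>: "\<tau> \<nearrow> {(1, 1)}"
  have "card \<tau> = 0" using adds_box_card[OF \<tau>] by simp
  then show "\<tau> = {}" using young_diagram_finite[OF adds_box_young(1)[OF \<tau>]] by simp
next
  assume "\<tau> = {}"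
  then show "\<tau> \<nearrow> {(1, 1)}" by (simp only: empty_adds_box)
qed

lemma down_power_singleton:
  fixes f :: "diagram \<Rightarrow> real"
  assumes D: "D \<in> partitions (Suc m)"
  shows "(down ^^ m) f D = num_tableaux D * f {(1, 1)}"
proof -
  \<comment> \<open>On one-box diagrams \<open>f\<close> equals \<open>down\<close> of a constant,
    as the empty diagram is their only lower neighbour. This turns the descent into a complete
    one.\<close>
  have "(down ^^ m) f D = (down ^^ m) (down (\<lambda>_. f {(1, 1)})) D"
  proof (rule down_power_cong)
    fix \<tau> assume "young_diagram \<tau>" "card \<tau> + m = card D"
    then have "\<tau> \<in> partitions 1" using partitions_card[OF D] by (auto simp: partitions_def)
    then have "\<tau> = {(1, 1)}" using partitions_1 by auto
    then show "f \<tau> = down (\<lambda>_. f {(1, 1)}) \<tau>"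
      by (simp add: down_def adds_box_singleton[simplified])
  qed (rule partitions_young[OF D])
  then show ?thesis
    using down_power_full[OF D, of "\<lambda>_. f {(1, 1)}"] by (simp only: funpow_Suc_right o_apply)
qed

text \<open>Removing all boxes forgets \<open>D\<close>: the descent contributes only the factor
  \<open>num_tableaux D\<close>, which cancels. The ascent to \<open>E\<close> and the conjugation
  each contribute \<open>num_tableaux E\<close>, whence the square in the z-measure.\<close>

lemma down_up_steps_full:
  assumes adm: "admissible_params z z'" and D: "D \<in> partitions n" and E: "E \<in> partitions n"
  shows "num_tableaux E / num_tableaux D * down_up_steps (box_weight z z') n n (delta E) D =
    z_measure z z' n E"
proof -
  define t where "t = box_weight z z' 0"
  have "(\<Prod>j<n. (real n - real j) * (t + real n - real j - 1)) =
      (\<Prod>i<n. real (Suc i) * (t + real i))"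
    unfolding prod.nat_diff_reindex[symmetric, of "\<lambda>i. real (Suc i) * (t + real i)"]
    by (intro prod.cong) (auto simp: of_nat_diff algebra_simps)
  also have "\<dots> = fact n * pochhammer t n"
    unfolding prod.distrib pochhammer_prod fact_prod_Suc by (simp add: lessThan_atLeast0)
  finally have Z: "(\<Prod>j<n. (real n - real j) * (t + real n - real j - 1)) = fact n * pochhammer t n" .
  have "num_tableaux D \<noteq> 0" using num_tableaux_pos[OF partitions_young[OF D]] by simp
  then show ?thesis
    unfolding down_up_steps_def down_power_full[OF D] up_power_delta_full[OF E]
      z_measure_real[OF adm] t_def[symmetric] Z
    by (simp add: power2_eq_square)
qed

text \<open>There is only one diagram with one box, so stopping the descent there loses nothing.\<close>

lemma down_up_steps_one_less:
  assumes "0 < v 0" and D: "D \<in> partitions (Suc m)"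
  shows "down_up_steps v (Suc m) m f D = down_up_steps v (Suc m) (Suc m) f D"
proof -
  have "(up v ^^ Suc m) f {} = v 0 * (up v ^^ m) f {(1, 1)}"
    using added_box_insert[of "(1, 1)" "{}"]
    by (simp add: up_def[of v "(up v ^^ m) f"] empty_adds_box box_content_def)
  \<comment> \<open>The normalising product with \<open>Suc m\<close> factors has the extra factor
    \<open>1 * v 0\<close>, which cancels the weight of the box \<open>(1, 1)\<close>.\<close>
  then show ?thesis
    unfolding down_up_steps_def down_power_full[OF D] down_power_singleton[OF D]
    using assms(1) by simp
qed

section \<open>The extremal pair and the maximal separation\<close>

definition row_diagram :: "nat \<Rightarrow> diagram" where
  "row_diagram n = {1} \<times> {1..n}"

definition column_diagram :: "nat \<Rightarrow> diagram" where
  "column_diagram n = {1..n} \<times> {1}"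

lemma row_diagram_partition: "row_diagram n \<in> partitions n"
  and column_diagram_partition: "column_diagram n \<in> partitions n"
  unfolding partitions_def young_diagram_def row_diagram_def column_diagram_def by auto

text \<open>After \<open>k\<close> removals at least two boxes of the row remain, among them
  \<open>(1, 2)\<close>. Adding boxes cannot lose it, and the column does not contain it.\<close>

lemma down_up_steps_row_column:
  assumes "Suc k < n"
  shows "down_up_steps v n k (delta (column_diagram n)) (row_diagram n) = 0"
proof -
  have "(down ^^ k) ((up v ^^ k) (delta (column_diagram n))) (row_diagram n) =
      (down ^^ k) (\<lambda>_. 0) (row_diagram n)"
  proof (rule down_power_cong)
    fix \<tau> assume \<tau>: "young_diagram \<tau>" "\<tau> \<subseteq> row_diagram n"
      and "card \<tau> + k = card (row_diagram n)"
    then have "card \<tau> > 1" using assms partitions_card[OF row_diagram_partition[of n]] by simp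
    then have "\<not> \<tau> \<subseteq> {(1, 1)}" using card_mono[of "{(1, 1)}" \<tau>] by auto
    then obtain j where "(1, j) \<in> \<tau>" "j \<noteq> 1" using \<tau>(2) unfolding row_diagram_def by auto
    then have mem: "(1, 2) \<in> \<tau>"
      using young_diagram_below[OF \<tau>(1), of 1 j 1 2] young_diagram_pos[OF \<tau>(1), of 1 j] by simp
    show "(up v ^^ k) (delta (column_diagram n)) \<tau> = 0"
    proof (rule up_power_eq_0[OF \<tau>(1)])
      fix D assume "\<tau> \<subseteq> D"
      then have "D \<noteq> column_diagram n" using mem unfolding column_diagram_def by auto
      then show "delta (column_diagram n) D = 0" by simp
    qed
  qed (rule partitions_young[OF row_diagram_partition])
  then show ?thesis unfolding down_up_steps_def by (simp add: down_power_0)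
qed

lemma z_measure_pos:
  assumes "admissible_params z z'" "D \<in> partitions n"
  shows "0 < z_measure z z' n D"
  unfolding z_measure_real[OF assms(1)]
  using num_tableaux_pos[OF partitions_young[OF assms(2)]] box_weight_pos[OF assms(1)]
  by (intro divide_pos_pos mult_pos_pos prod_pos pochhammer_pos zero_less_power) auto

text \<open>The levels \<open>m\<close> and \<open>Suc m\<close> both yield the z-measure, so
  relative to it they contribute the probability that the birth chain is in one of these two states.
  Its complement is the first sum; the second collects the levels below \<open>m\<close>.\<close>

lemma separation_expansion:
  assumes adm: "admissible_params z z'"
    and D: "D \<in> partitions (Suc m)" and E: "E \<in> partitions (Suc m)"
  defines "v \<equiv> box_weight z z'" and "p \<equiv> birth_rate (box_weight z z' 0) (Suc m)"
  shows "1 - kernel_power (partitions (Suc m)) (down_up z z' (Suc m)) r D E / z_measure z z' (Suc m) E =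
    (\<Sum>k<m. birth p r k) - num_tableaux E / num_tableaux D / z_measure z z' (Suc m) E *
      (\<Sum>k<m. birth p r k * down_up_steps v (Suc m) k (delta E) D)"
proof -
  define W where "W k = down_up_steps v (Suc m) k (delta E) D" for k
  define \<pi> where "\<pi> = z_measure z z' (Suc m) E"
  define d where "d = real (num_tableaux E) / real (num_tableaux D)"
  define N where "N = Suc m * (v 0 + Suc m - 1)"
  have v0: "0 < v 0" unfolding v_def by (rule box_weight_pos[OF adm])
  have N: "N \<noteq> 0" unfolding N_def using v0 by simp
  have \<pi>: "0 < \<pi>" unfolding \<pi>_def by (rule z_measure_pos[OF adm E])
  have top: "d * W (Suc m) = \<pi>"
    unfolding d_def W_def v_def \<pi>_def by (rule down_up_steps_full[OF adm D E])
  have below_top: "W m = W (Suc m)"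
    unfolding W_def by (rule down_up_steps_one_less[where v = v, OF v0 D])
  have split: "(\<Sum>k\<le>Suc m. h k) = (\<Sum>k<m. h k) + h m + h (Suc m)" for h :: "nat \<Rightarrow> real"
    by (simp flip: lessThan_Suc_atMost)
  have total: "(\<Sum>k<m. birth p r k) + birth p r m + birth p r (Suc m) = 1"
    unfolding split[symmetric] by (rule birth_total) (simp add: p_def birth_rate_def)
  have "kernel_power (partitions (Suc m)) (down_up z z' (Suc m)) r D E =
      d * (\<Sum>k\<le>Suc m. birth p r k * W k)"
  proof -
    have pow: "((down \<circ> up v) ^^ r) (delta E) D = N ^ r * (\<Sum>k\<le>Suc m. birth p r k * W k)"
      using down_up_power[of v, OF box_weight_second_difference[of z z', folded v_def] v0 _ D]
      unfolding N_def p_def W_def v_def by simp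
    have "kernel_power (partitions (Suc m)) (down_up z z' (Suc m)) r D E =
        d * ((down \<circ> up v) ^^ r) (delta E) D / N ^ r"
      using kernel_power_down_up[OF adm _ E D] unfolding N_def d_def v_def by simp
    then show ?thesis using N unfolding pow by simp
  qed
  also have "\<dots> = d * (\<Sum>k<m. birth p r k * W k) + (birth p r m + birth p r (Suc m)) * \<pi>"
    unfolding split below_top top[symmetric] by (simp add: algebra_simps)
  finally have "1 - kernel_power (partitions (Suc m)) (down_up z z' (Suc m)) r D E / \<pi> =
      1 - (birth p r m + birth p r (Suc m)) - d / \<pi> * (\<Sum>k<m. birth p r k * W k)"
    using \<pi> by (simp add: add_divide_distrib)
  then show ?thesis using total unfolding W_def \<pi>_def d_def by simp
qed

text \<open>By \<open>separation_expansion\<close> every pair gives \<open>?s\<close> minus a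
  nonnegative quantity, and that quantity is 0 from the row to the column.\<close>

lemma s_star_eq:
  assumes adm: "admissible_params z z'"
  shows "s_star z z' (Suc m) r = (\<Sum>k<m. birth (birth_rate (box_weight z z' 0) (Suc m)) r k)"
    (is "_ = ?s")
  unfolding s_star_def max_separation_def
proof (rule Max_eqI)
  let ?P = "partitions (Suc m)"
  let ?p = "birth_rate (box_weight z z' 0) (Suc m)"
  let ?h = "\<lambda>D E. 1 - kernel_power ?P (down_up z z' (Suc m)) r D E / z_measure z z' (Suc m) E"
  show "finite ((\<lambda>(D, E). ?h D E) ` (?P \<times> ?P))"
    using finite_partitions by auto
  show "s \<le> ?s" if s: "s \<in> (\<lambda>(D, E). ?h D E) ` (?P \<times> ?P)" for s
  proof -
    from s obtain D E where DE: "D \<in> ?P" "E \<in> ?P" and s: "s = ?h D E" by auto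
    have v0: "0 < box_weight z z' 0" by (rule box_weight_pos[OF adm])
    have "0 \<le> birth ?p r k * down_up_steps (box_weight z z') (Suc m) k (delta E) D" if "k < m" for k
    proof (intro mult_nonneg_nonneg birth_nonneg)
      show "?p j \<in> {0..1}" if "j \<le> k" for j
        using that \<open>k < m\<close> by (intro birth_rate_bounds v0) auto
      show "0 \<le> down_up_steps (box_weight z z') (Suc m) k (delta E) D"
        unfolding down_up_steps_def
      proof (intro divide_nonneg_nonneg prod_nonneg ballI mult_nonneg_nonneg)
        show "0 \<le> (down ^^ k) ((up (box_weight z z') ^^ k) (delta E)) D"
          using box_weight_pos[OF adm] by (intro down_nonneg up_nonneg) (auto intro: less_imp_le)
      qed (use that v0 in auto)
    qed
    then have "0 \<le> (\<Sum>k<m. birth ?p r k * down_up_steps (box_weight z z') (Suc m) k (delta E) D)"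
      by (intro sum_nonneg) auto
    then show ?thesis
      unfolding s separation_expansion[OF adm DE]
      using z_measure_pos[OF adm DE(2)] by simp
  qed
  have "?h (row_diagram (Suc m)) (column_diagram (Suc m)) = ?s"
    unfolding separation_expansion[OF adm row_diagram_partition column_diagram_partition]
    by (simp add: down_up_steps_row_column)
  then show "?s \<in> (\<lambda>(D, E). ?h D E) ` (?P \<times> ?P)"
    using row_diagram_partition column_diagram_partition
    by (intro image_eqI[where x = "(row_diagram (Suc m), column_diagram (Suc m))"]) auto
qed

theorem corollary5p4:
  fixes n r :: nat and z z' :: complex
    and M :: "'a measure" and X :: "nat \<Rightarrow> 'a \<Rightarrow> nat"
  assumes "n \<ge> 1"
    and "admissible_params z z'"
    and "prob_space M"
    and "prob_space.indep_vars M (\<lambda>_. count_space UNIV) X {..<n - 1}"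
    and "\<And>i. i < n - 1 \<Longrightarrow> geometric_rv M (geom_param z z' n i) (X i)"
  shows "s_star z z' n r = measure M {\<omega> \<in> space M. (\<Sum>i<n - 1. X i \<omega>) > r}"
proof -
  interpret prob_space M by fact
  define p where "p = birth_rate (box_weight z z' 0) n"
  have p: "geom_param z z' n i = p i" for i
    unfolding p_def by (rule geom_param_birth_rate[OF assms(2,1)])
  have [measurable]: "X i \<in> measurable M (count_space UNIV)" if "i < n - 1" for i
    using assms(5)[OF that] unfolding geometric_rv_def by simp
  have "{\<omega> \<in> space M. (\<Sum>i<n - 1. X i \<omega>) > r} =
      space M - {\<omega> \<in> space M. (\<Sum>i<n - 1. X i \<omega>) \<le> r}" by auto
  also have "prob \<dots> = 1 - prob {\<omega> \<in> space M. (\<Sum>i<n - 1. X i \<omega>) \<le> r}"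
    by (rule prob_compl) measurable
  \<comment> \<open>The probability that the birth chain is still below \<open>n - 1\<close> at time
    \<open>r\<close>, the common value of both sides.\<close>
  also have "\<dots> = (\<Sum>k<n - 1. birth p r k)"
    using prob_geometric_sum_le[OF assms(4), of p "n - 1" r] assms(5)
      geom_param_bounds[OF assms(2), of _ n]
    unfolding p by simp
  also have "\<dots> = s_star z z' n r"
    using s_star_eq[OF assms(2), of "n - 1" r] assms(1) unfolding p_def by simp
  finally show ?thesis ..
qed

end
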